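(* Let $h(x)\in\mathbb{F}_q(x)$ be a nonconstant rational function, let $t=h(x)$, and let $a,b\in\mathbb{P}^1(\mathbb{F}_q)\setminus\{\infty\}$. Then $h(a)=b$ if and only if the place $P_a$ of $\mathbb{F}_q(x)$ lies over the place $P_b$ of $\mathbb{F}_q(t)$. In particular, $\#h^{-1}(b)=\deg(h)$ if and only if $P_b$ splits totally in the extension $\mathbb{F}_q(x)/\mathbb{F}_q(t)$.
   Context: $q$ is a prime power and $\mathbb{P}^1(\mathbb{F}_q)=\mathbb{F}_q\cup\{\infty\}$. For $h=f/g$ with $f,g\in\mathbb{F}_q[x]$ coprime, $\deg(h)=\max\{\deg f,\deg g\}$, and $h$ induces a map $\mathbb{P}^1(\mathbb{F}_q)\to\mathbb{P}^1(\mathbb{F}_q)$ by evaluation; $h^{-1}(b)=\{Q\in\mathbb{P}^1(\mathbb{F}_q): h(Q)=b\}$ (which may contain $\infty$). With $t=h(x)$, $\mathbb{F}_q(x)/\mathbb{F}_q(t)$ is an extension of degree $\deg(h)$. For $a\in\mathbb{F}_q$, $P_a$ denotes the rational place of $\mathbb{F}_q(x)$ that is the zero of $x-a$, and for $b\in\mathbb{F}_q$, $P_b$ denotes the rational place of $\mathbb{F}_q(t)$ that is the zero of $t-b$. A place $P$ of $F$ splits totally in a finite extension $F'/F$ if there are exactly $[F':F]$ places of $F'$ lying over $P$. *)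

theory Defs
  imports "HOL-Algebra.Algebra" "HOL-Algebra.Algebraic_Closure_Type"
begin

section \<open>Places of function fields\<close>

text \<open>
  All fields are subfields, given as sets, of one ambient field \<open>L\<close>; \<open>K\<close> is the field of
  constants.  Valuation rings of \<open>F/K\<close>, places and "lying over" follow Stichtenoth,
  Algebraic Function Fields and Codes.
\<close>

definition valuation_ring :: "('a, 'm) ring_scheme \<Rightarrow> 'a set \<Rightarrow> 'a set \<Rightarrow> 'a set \<Rightarrow> bool" where
  "valuation_ring L K F V \<longleftrightarrow>
     subring V L \<and> K \<subset> V \<and> V \<subset> F \<and> (\<forall>z\<in>F - {\<zero>\<^bsub>L\<^esub>}. z \<in> V \<or> inv\<^bsub>L\<^esub> z \<in> V)"

definition place :: "('a, 'm) ring_scheme \<Rightarrow> 'a set \<Rightarrow> 'a set \<Rightarrow> 'a set \<Rightarrow> bool" where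
  "place L K F P \<longleftrightarrow> (\<exists>V. valuation_ring L K F V \<and> maximalideal P (L\<lparr>carrier := V\<rparr>))"

text \<open>A place is rational if its degree, the dimension over \<open>K\<close> of the residue field \<open>V/P\<close>, is 1;
  here \<open>K\<close> is identified with its image in \<open>V/P\<close>.\<close>

definition rational_place :: "('a, 'm) ring_scheme \<Rightarrow> 'a set \<Rightarrow> 'a set \<Rightarrow> 'a set \<Rightarrow> bool" where
  "rational_place L K F P \<longleftrightarrow>
     (\<exists>V. valuation_ring L K F V \<and> maximalideal P (L\<lparr>carrier := V\<rparr>) \<and>
        (let R = L\<lparr>carrier := V\<rparr> Quot P
         in ring.dimension R 1 ((\<lambda>c. P +>\<^bsub>L\<lparr>carrier := V\<rparr>\<^esub> c) ` K) (carrier R)))"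

text \<open>A zero of \<open>z\<close> is a place at which \<open>z\<close> has positive valuation, i.e. a place containing \<open>z\<close>.
  The description is used below only for elements with exactly one rational zero.\<close>

definition the_rational_zero :: "('a, 'm) ring_scheme \<Rightarrow> 'a set \<Rightarrow> 'a set \<Rightarrow> 'a \<Rightarrow> 'a set" where
  "the_rational_zero L K F z = (THE P. rational_place L K F P \<and> z \<in> P)"

text \<open>\<open>P'\<close>, a place of \<open>F'\<close>, lies over \<open>P\<close>, a place of the subfield \<open>F\<close>.\<close>

definition lies_over ::
  "('a, 'm) ring_scheme \<Rightarrow> 'a set \<Rightarrow> 'a set \<Rightarrow> 'a set \<Rightarrow> 'a set \<Rightarrow> 'a set \<Rightarrow> bool" where
  "lies_over L K F' F P' P \<longleftrightarrow> place L K F' P' \<and> place L K F P \<and> P \<subseteq> P'"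

definition splits_totally ::
  "('a, 'm) ring_scheme \<Rightarrow> 'a set \<Rightarrow> 'a set \<Rightarrow> 'a set \<Rightarrow> 'a set \<Rightarrow> bool" where
  "splits_totally L K F' F P \<longleftrightarrow>
     place L K F P \<and> ring.finite_dimension L F F' \<and>
     card {P'. lies_over L K F' F P' P} = ring.dim L F F'"


section \<open>Rational functions and the projective line\<close>

text \<open>The field $k(x)$ is the type \<open>'a poly fract\<close>, with \<open>k\<close> the type \<open>'a\<close>.\<close>

abbreviation ratfun_field :: "'a::field poly fract ring" where
  "ratfun_field \<equiv> ring_of_type_algebra"

definition const_fun :: "'a::field \<Rightarrow> 'a poly fract" where
  "const_fun c = to_fract [:c:]"

definition x_fun :: "'a::field poly fract" where
  "x_fun = to_fract [:0, 1:]"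

definition constants :: "'a::field poly fract set" where
  "constants = range const_fun"

text \<open>The subfield $k(t)$ of $k(x)$.\<close>

definition subfield_gen :: "'a::field poly fract \<Rightarrow> 'a poly fract set" where
  "subfield_gen t = generate_field ratfun_field (constants \<union> {t})"

definition num_denom :: "'a::field poly fract \<Rightarrow> 'a poly \<times> 'a poly" where
  "num_denom h = (SOME (f, g). coprime f g \<and> g \<noteq> 0 \<and> h = Fract f g)"

definition ratfun_degree :: "'a::field poly fract \<Rightarrow> nat" where
  "ratfun_degree h = (let (f, g) = num_denom h in max (degree f) (degree g))"

datatype 'a proj_line = Affine 'a | Infinity

text \<open>At infinity, $f/g$ of degree \<open>d\<close> takes the value of the homogenized pair at $(1:0)$,
  which is the ratio of the coefficients of $x^d$; they are not both zero.\<close>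

fun ratfun_eval :: "'a::field poly fract \<Rightarrow> 'a proj_line \<Rightarrow> 'a proj_line" where
  "ratfun_eval h (Affine a) =
     (let (f, g) = num_denom h
      in if poly g a = 0 then Infinity else Affine (poly f a / poly g a))"
| "ratfun_eval h Infinity =
     (let (f, g) = num_denom h; d = ratfun_degree h
      in if coeff g d = 0 then Infinity else Affine (coeff f d / coeff g d))"

definition place_x :: "'a::field \<Rightarrow> 'a poly fract set" where
  "place_x a = the_rational_zero ratfun_field constants UNIV (x_fun - const_fun a)"

definition place_t :: "'a::field poly fract \<Rightarrow> 'a \<Rightarrow> 'a poly fract set" where
  "place_t t b = the_rational_zero ratfun_field constants (subfield_gen t) (t - const_fun b)"

end

theory Submission
  imports Defs
begin

text \<open>
  A valuation ring \<open>V\<close> is local, its place being the set of its nonunits.  If \<open>t\<close> is not constant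
  and \<open>V\<close> is a valuation ring of $k(t)$ containing \<open>t\<close>, its place contracts to a nonzero prime ideal
  of $k[t]$ and is determined by the monic irreducible generator; applied to \<open>t\<close>, \<open>x\<close> and \<open>1 / x\<close>
  this describes $P_b$ and all places of $k(x)$.  A place of $k(x)$ lies over $P_b$ iff it
  contains $t - b = N / g$, where $t = f / g$ is in lowest terms and $N = f - b g$.  So the places over
  $P_b$ are those of the monic irreducible divisors of \<open>N\<close>, and infinity if $\deg N < \deg g$, while
  $h^{-1}(b)$ consists of the roots of \<open>N\<close>, and infinity under the same condition.  As
  $[k(x):k(t)] = \deg h = \max(\deg N, \deg g)$, either count reaches the degree iff \<open>N\<close> is a product of
  distinct linear factors and $\deg N \ge \deg h - 1$.
\<close>

section \<open>Polynomials over a field and their values at rational functions\<close>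

text \<open>\<open>place_x\<close> and \<open>place_t\<close> are definite descriptions, so nothing
  about them is available until exactly one rational zero is exhibited; the classification of places
  is needed for that uniqueness as well as for the count. The degree of the extension is a
  dimension, so it is obtained from an explicit basis \<open>1, x, ..., x^(d-1)\<close>, with
  \<open>d\<close> the degree of \<open>t\<close>: a relation over \<open>k(t)\<close>, its
  denominators cleared, becomes a form in \<open>f\<close> and \<open>g\<close> that divisibility
  forces to vanish, and \<open>f(x) - t g(x) = 0\<close> brings \<open>x^d\<close> back into the
  span. The two counts can differ for a given \<open>b\<close>, since an irreducible divisor of
  \<open>N\<close> of higher degree gives a place but no root; they are compared only at their
  maximum, through \<open>#roots <= #divisors <= deg N\<close>. Infinity contributes equally to both
  counts, and when it does, \<open>deg N\<close> falls short of the degree by at least one. No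
  equation between ramification indices, residue degrees and the degree is invoked.\<close>

lemma poly_bezout:
  fixes f g :: "'a::field poly"
  assumes "coprime f g"
  shows "\<exists>r s. r * f + s * g = 1"
proof -
  \<comment> \<open>The ideal generated by \<open>f\<close> and \<open>g\<close>. An element of
    least degree divides all others by division with remainder, so it is a common divisor of
    \<open>f\<close> and \<open>g\<close>, hence a unit.\<close>
  define I where "I = {e. \<exists>r s. e = r * f + s * g}"
  have I_diff: "u - w * v \<in> I" if "u \<in> I" "v \<in> I" for u v w
  proof -
    from that obtain r s r' s' where "u = r * f + s * g" "v = r' * f + s' * g"
      unfolding I_def by blast
    then have "u - w * v = (r - w * r') * f + (s - w * s') * g" by (simp add: algebra_simps)
    then show ?thesis unfolding I_def by blast
  qed
  have "f = 1 * f + 0 * g" "g = 0 * f + 1 * g" by simp_all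
  then have fg: "f \<in> I" "g \<in> I" unfolding I_def by blast+
  have "f \<noteq> 0 \<or> g \<noteq> 0" using assms by auto
  with fg have "\<exists>e. e \<in> I \<and> e \<noteq> 0" by blast
  from ex_has_least_nat[of "\<lambda>e. e \<in> I \<and> e \<noteq> 0" _ degree] this
  obtain e where e: "e \<in> I" "e \<noteq> 0" and least: "\<And>y. y \<in> I \<Longrightarrow> y \<noteq> 0 \<Longrightarrow> degree e \<le> degree y"
    by metis
  have dvd: "e dvd u" if "u \<in> I" for u
  proof -
    have "u mod e \<in> I" using I_diff[OF that e(1), of "u div e"] by (simp add: minus_div_mult_eq_mod)
    then have "u mod e = 0" using least[of "u mod e"] degree_mod_less[OF e(2), of u] by force
    then show ?thesis by auto
  qed
  have "is_unit e" using assms dvd[OF fg(1)] dvd[OF fg(2)] by (auto simp: coprime_def)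
  then obtain c where "1 = e * c" by (rule dvdE)
  moreover from e(1) obtain r s where "e = r * f + s * g" unfolding I_def by blast
  ultimately have "(c * r) * f + (c * s) * g = 1" by (simp add: algebra_simps)
  then show ?thesis by blast
qed

lemma coprime_poly_dvd_mult:
  fixes f g m :: "'a::field poly"
  assumes "coprime f g" "f dvd g * m"
  shows "f dvd m"
proof -
  obtain r s where "r * f + s * g = 1" using poly_bezout[OF assms(1)] by blast
  then have "m = (r * f + s * g) * m" by simp
  then have "m = r * m * f + s * (g * m)" by (simp add: algebra_simps)
  then show ?thesis using assms(2) by (metis dvd_add dvd_triv_right dvd_mult)
qed

lemma coprime_poly_dvd_mult_power:
  fixes f g m :: "'a::field poly"
  assumes "coprime f g" "f dvd m * g ^ n"
  shows "f dvd m"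
  using assms(2)
proof (induction n)
  case (Suc n)
  then have "f dvd g * (m * g ^ n)" by (simp add: algebra_simps)
  then show ?case using coprime_poly_dvd_mult[OF assms(1)] Suc.IH by blast
qed simp

text \<open>Cancelling a common nonunit lowers the degree of the denominator, since over a field a
  nonzero nonunit has positive degree; induction on that degree therefore ends at a coprime
  pair.\<close>

lemma poly_reduce_quotient:
  fixes u v :: "'a::field poly"
  assumes "v \<noteq> 0"
  obtains c u' v' where "coprime u' v'" "u = c * u'" "v = c * v'" "v' \<noteq> 0" "c \<noteq> 0"
proof -
  have "\<exists>c u' v'. coprime u' v' \<and> u = c * u' \<and> v = c * v'"
    using assms
  proof (induction "degree v" arbitrary: u v rule: less_induct)
    case less
    show ?case
    proof (cases "coprime u v")
      case True
      then show ?thesis by (intro exI[of _ 1] exI[of _ u] exI[of _ v]) auto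
    next
      case False
      then obtain e where e: "e dvd u" "e dvd v" "\<not> is_unit e" by (auto simp: coprime_def)
      then obtain u1 v1 where uv: "u = e * u1" "v = e * v1" by (auto elim!: dvdE)
      with less.prems have nz: "e \<noteq> 0" "v1 \<noteq> 0" by auto
      then have "degree e \<noteq> 0" using e(3) by (auto simp: is_unit_iff_degree)
      then have "degree v1 < degree v" using uv nz by (simp add: degree_mult_eq)
      from less.hyps[OF this nz(2), of u1] obtain c u' v'
        where "coprime u' v'" "u1 = c * u'" "v1 = c * v'" by blast
      then show ?thesis using uv by (intro exI[of _ "e * c"] exI[of _ u'] exI[of _ v']) auto
    qed
  qed
  with that assms show ?thesis by (metis mult_zero_left mult_zero_right)
qed

text \<open>Every term except the top one carries a factor \<open>g\<close>, so \<open>g\<close>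
  divides \<open>A n * f ^ n\<close> and, by coprimality, \<open>A n\<close>. The degree bound makes
  \<open>A n\<close> zero; then \<open>g\<close> cancels and \<open>n\<close> drops by one.\<close>

lemma coprime_homogeneous_sum_zero_aux:
  fixes f g :: "'a::field poly"
  assumes "coprime f g"
    and "\<And>j. j \<le> n \<Longrightarrow> degree (A j) < degree g"
    and "(\<Sum>j\<le>n. A j * f ^ j * g ^ (n - j)) = 0"
  shows "\<forall>j\<le>n. A j = 0"
  using assms(2,3)
proof (induction n)
  case (Suc n)
  have eq: "(\<Sum>j\<le>n. A j * f ^ j * g ^ (Suc n - j)) = g * (\<Sum>j\<le>n. A j * f ^ j * g ^ (n - j))"
    unfolding sum_distrib_left by (rule sum.cong) (auto simp: Suc_diff_le algebra_simps)
  have sum: "g * (\<Sum>j\<le>n. A j * f ^ j * g ^ (n - j)) + A (Suc n) * f ^ Suc n = 0"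
    using Suc.prems(2) unfolding sum.atMost_Suc eq by simp
  then have "A (Suc n) * f ^ Suc n = g * (- (\<Sum>j\<le>n. A j * f ^ j * g ^ (n - j)))"
    by (simp add: eq_neg_iff_add_eq_0 add.commute)
  then have "g dvd A (Suc n) * f ^ Suc n" by (metis dvd_triv_left)
  then have "g dvd A (Suc n)"
    using coprime_poly_dvd_mult_power assms(1) coprime_commute by blast
  then have z: "A (Suc n) = 0"
    using Suc.prems(1)[of "Suc n"] dvd_imp_degree_le[of g "A (Suc n)"] by (meson leD order_refl)
  moreover have "g \<noteq> 0" using Suc.prems(1)[of 0] by auto
  ultimately have "(\<Sum>j\<le>n. A j * f ^ j * g ^ (n - j)) = 0" using sum by simp
  then have "\<forall>j\<le>n. A j = 0" by (intro Suc.IH Suc.prems(1)) simp_all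
  with z show ?case by (auto simp: le_Suc_eq)
qed simp

text \<open>The extremal coefficients of the vanishing form are divisible by \<open>f\<close> or by \<open>g\<close>, one of which
  has larger degree than all coefficients.\<close>

lemma coprime_homogeneous_sum_zero:
  fixes f g :: "'a::field poly"
  assumes cop: "coprime f g"
    and deg: "\<And>j. j \<le> n \<Longrightarrow> degree (A j) < max (degree f) (degree g)"
    and sum: "(\<Sum>j\<le>n. A j * f ^ j * g ^ (n - j)) = 0"
    and "j \<le> n"
  shows "A j = 0"
proof (cases "degree f \<le> degree g")
  case True
  then show ?thesis
    using coprime_homogeneous_sum_zero_aux[OF cop _ sum] deg \<open>j \<le> n\<close> by (simp add: max_def)
next
  case False
  \<comment> \<open>Reversing the order of the coefficients exchanges \<open>f\<close> and
    \<open>g\<close>, so that the polynomial of larger degree takes the place of the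
    divisor.\<close>
  have "(\<Sum>j\<le>n. A (n - j) * g ^ j * f ^ (n - j)) = (\<Sum>j\<le>n. A j * f ^ j * g ^ (n - j))"
    by (rule sum.reindex_bij_witness[of _ "\<lambda>j. n - j" "\<lambda>j. n - j"]) (auto simp: mult_ac)
  then have "\<forall>j\<le>n. A (n - j) = 0"
    using coprime_homogeneous_sum_zero_aux[of g f n "\<lambda>j. A (n - j)"] cop deg sum False
    by (simp add: coprime_commute max_def)
  then show ?thesis using \<open>j \<le> n\<close> by (metis diff_diff_cancel diff_le_self)
qed

section \<open>Constants and substitution of a rational function into polynomials\<close>

lemma const_fun_simps [simp]:
  "const_fun 0 = 0" "const_fun 1 = 1" "const_fun (c + e) = const_fun c + const_fun e"
  "const_fun (c * e) = const_fun c * const_fun e" "const_fun (- c) = - const_fun c"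
  "const_fun (c - e) = const_fun c - const_fun e"
  by (simp_all add: const_fun_def pCons_one flip: to_fract_add to_fract_mult to_fract_uminus to_fract_diff)

lemma const_fun_eq_iff [simp]: "const_fun c = const_fun e \<longleftrightarrow> c = e"
  by (simp add: const_fun_def)

lemma const_fun_eq_0_iff [simp]: "const_fun c = 0 \<longleftrightarrow> c = 0"
  by (simp add: const_fun_def)

lemma inverse_const_fun: "inverse (const_fun c) = const_fun (inverse c)"
proof (cases "c = 0")
  case False
  then have "const_fun c * const_fun (inverse c) = 1"
    using const_fun_simps(4)[of c "inverse c"] by simp
  then show ?thesis by (rule inverse_unique)
qed simp

lemma const_fun_in_constants [simp]: "const_fun c \<in> constants"
  by (simp add: constants_def)

text \<open>The \<open>k\<close>-algebra homomorphism sending the variable to \<open>t\<close>, with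
  image \<open>k[t]\<close>. Divisibility can thus be studied in \<open>'a poly\<close> while the
  values live in \<open>k(x)\<close>.\<close>

definition poly_at :: "'a::field poly fract \<Rightarrow> 'a poly \<Rightarrow> 'a poly fract" where
  "poly_at t u = poly (map_poly const_fun u) t"

lemma poly_at_0 [simp]: "poly_at t 0 = 0"
  by (simp add: poly_at_def)

lemma poly_at_pCons [simp]: "poly_at t (pCons c u) = const_fun c + t * poly_at t u"
  by (simp add: poly_at_def map_poly_pCons)

lemma poly_at_1 [simp]: "poly_at t 1 = 1"
  by (simp add: one_pCons)

lemma poly_at_add [simp]: "poly_at t (u + v) = poly_at t u + poly_at t v"
  by (induction u v rule: poly_induct2) (simp_all add: algebra_simps)

lemma poly_at_diff [simp]: "poly_at t (u - v) = poly_at t u - poly_at t v"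
  using poly_at_add[of t "u - v" v] by (simp del: poly_at_add)

lemma poly_at_uminus [simp]: "poly_at t (- u) = - poly_at t u"
  using poly_at_diff[of t 0 u] by simp

lemma poly_at_smult [simp]: "poly_at t (smult c u) = const_fun c * poly_at t u"
  by (induction u) (simp_all add: algebra_simps)

lemma poly_at_mult [simp]: "poly_at t (u * v) = poly_at t u * poly_at t v"
  by (induction u) (simp_all add: algebra_simps)

lemma poly_at_x_fun [simp]: "poly_at x_fun u = to_fract u"
proof (induction u)
  case (pCons c u)
  have "to_fract (pCons c u) = to_fract ([:c:] + [:0, 1:] * u)" by simp
  then show ?case using pCons unfolding to_fract_add to_fract_mult
    by (simp add: const_fun_def x_fun_def)
qed simp

lemma poly_at_altdef:
  assumes "degree u \<le> n"
  shows "poly_at t u = (\<Sum>j\<le>n. const_fun (coeff u j) * t ^ j)"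
proof -
  have "degree (map_poly const_fun u) \<le> n" 
    using assms map_poly_degree_leq order_trans by blast
  then have "poly_at t u = (\<Sum>j\<le>n. coeff (map_poly const_fun u) j * t ^ j)"
    unfolding poly_at_def poly_altdef
    by (intro sum.mono_neutral_left) (auto simp: coeff_eq_0)
  then show ?thesis by (simp add: coeff_map_poly)
qed

text \<open>\<open>num_denom\<close> is an arbitrary choice among pairs differing by a unit; these
  three properties are all that is ever used of the chosen pair.\<close>

lemma num_denom_props:
  assumes "num_denom h = (f, g)"
  shows "coprime f g" "g \<noteq> 0" "h = to_fract f / to_fract g"
proof -
  obtain u v where uv: "h = Fract u v" "v \<noteq> 0" by (cases h) auto
  obtain c u' v' where c: "coprime u' v'" "u = c * u'" "v = c * v'" "v' \<noteq> 0" "c \<noteq> 0"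
    using poly_reduce_quotient[OF uv(2)] .
  then have "h = Fract u' v'" using uv by (simp add: eq_fract)
  then have "\<exists>p. case p of (f, g) \<Rightarrow> coprime f g \<and> g \<noteq> 0 \<and> h = Fract f g" using c by auto
  from someI_ex[OF this] have "case num_denom h of (f, g) \<Rightarrow> coprime f g \<and> g \<noteq> 0 \<and> h = Fract f g"
    unfolding num_denom_def .
  then show "coprime f g" "g \<noteq> 0" "h = to_fract f / to_fract g"
    using assms by (auto simp: Fract_conv_to_fract)
qed

lemma ratfun_degree_pos:
  assumes "h \<notin> constants"
  shows "ratfun_degree h > 0"
proof (rule ccontr)
  obtain f g where fg: "num_denom h = (f, g)" by fastforce
  assume "\<not> ratfun_degree h > 0"
  then have "degree f = 0" "degree g = 0" by (simp_all add: ratfun_degree_def fg)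
  then obtain c e where "f = [:c:]" "g = [:e:]" by (meson degree_eq_zeroE)
  then have "h = const_fun c * inverse (const_fun e)"
    using num_denom_props(3)[OF fg] by (simp add: const_fun_def divide_inverse)
  then show False using assms by (metis const_fun_in_constants const_fun_simps(4) inverse_const_fun)
qed

text \<open>With coefficients \<open>A j\<close> in \<open>k\<close> this is the transcendence of \<open>t\<close>; in general it is the linear
  independence over \<open>k(t)\<close> of the powers of \<open>x\<close> below the degree of \<open>t\<close>.\<close>

lemma sum_to_fract_mult_power_zero:
  fixes t :: "'a::field poly fract"
  assumes deg: "\<And>j. j \<le> n \<Longrightarrow> degree (A j) < ratfun_degree t"
    and sum: "(\<Sum>j\<le>n. to_fract (A j) * t ^ j) = 0"
    and "j \<le> n"
  shows "A j = 0"
proof -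
  obtain f g where fg: "num_denom t = (f, g)" by fastforce
  note nd = num_denom_props[OF fg]
  \<comment> \<open>As \<open>t = f / g\<close>, multiplication by \<open>g ^ n\<close> turns the
    relation into a form of degree \<open>n\<close> in \<open>f\<close> and
    \<open>g\<close>.\<close>
  have "to_fract (A j) * t ^ j * to_fract g ^ n = to_fract (A j * f ^ j * g ^ (n - j))"
    if "j \<le> n" for j
  proof -
    have pw: "to_fract (p ^ k) = to_fract p ^ k" for p :: "'a poly" and k
      by (induction k) simp_all
    have "to_fract g ^ n = to_fract g ^ j * to_fract g ^ (n - j)"
      using that by (simp flip: power_add)
    then show ?thesis using nd(2) by (simp add: nd(3) power_divide pw)
  qed
  then have "to_fract (\<Sum>j\<le>n. A j * f ^ j * g ^ (n - j)) =
      (\<Sum>j\<le>n. to_fract (A j) * t ^ j) * to_fract g ^ n"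
    unfolding to_fract_sum sum_distrib_right by (intro sum.cong) (metis atMost_iff)+
  then have "(\<Sum>j\<le>n. A j * f ^ j * g ^ (n - j)) = 0"
    unfolding sum mult_zero_left to_fract_eq_0_iff .
  then show ?thesis
    using coprime_homogeneous_sum_zero[OF nd(1), of n A j] deg \<open>j \<le> n\<close>
    by (simp add: ratfun_degree_def fg)
qed

text \<open>Constant polynomials have degree 0, which lies below \<open>ratfun_degree t\<close>
  because \<open>t\<close> is not constant, so the independence just proved applies.\<close>

lemma poly_at_eq_0_iff:
  assumes "t \<notin> constants"
  shows "poly_at t u = 0 \<longleftrightarrow> u = 0"
proof
  assume "poly_at t u = 0"
  then have "(\<Sum>j\<le>degree u. to_fract [:coeff u j:] * t ^ j) = 0"
    by (simp add: poly_at_altdef[OF order_refl] const_fun_def)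
  then have "[:lead_coeff u:] = 0"
    by (rule sum_to_fract_mult_power_zero[rotated]) (use ratfun_degree_pos[OF assms] in auto)
  then show "u = 0" by simp
qed simp

lemma poly_at_eq_iff:
  assumes "t \<notin> constants"
  shows "poly_at t u = poly_at t v \<longleftrightarrow> u = v"
  using poly_at_eq_0_iff[OF assms, of "u - v"] by auto

section \<open>Valuation rings\<close>

lemma ring_of_type_algebra_sel [simp]:
  "carrier ring_of_type_algebra = UNIV"
  "x \<otimes>\<^bsub>ring_of_type_algebra\<^esub> y = x * y"
  "x \<oplus>\<^bsub>ring_of_type_algebra\<^esub> y = x + y"
  "\<one>\<^bsub>ring_of_type_algebra\<^esub> = 1"
  "\<zero>\<^bsub>ring_of_type_algebra\<^esub> = 0"
  by (simp_all add: ring_of_type_algebra_def)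

lemma ring_of_type_algebra_minus [simp]:
  fixes x :: "'a::comm_ring_1"
  shows "\<ominus>\<^bsub>ring_of_type_algebra\<^esub> x = - x"
proof -
  interpret ring "ring_of_type_algebra :: 'a ring" by (rule ring_from_type_algebra)
  show ?thesis by (rule minus_equality) simp_all
qed

lemma ring_of_type_algebra_inv:
  fixes x :: "'a::Fields.field"
  assumes "x \<noteq> 0"
  shows "inv\<^bsub>ring_of_type_algebra\<^esub> x = inverse x"
proof -
  interpret field "ring_of_type_algebra :: 'a ring" by (rule field_from_type_algebra)
  show ?thesis by (rule comm_inv_char) (use assms in auto)
qed

text \<open>Zero is listed separately because \<open>inverse 0 = 0\<close>, which would make it look
  invertible.\<close>

definition nonunits :: "'a::Fields.field set \<Rightarrow> 'a set" where
  "nonunits V = {z \<in> V. z = 0 \<or> inverse z \<notin> V}"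

locale valuation =
  fixes K F V :: "'a::Fields.field set"
  assumes K_subset: "K \<subset> V" and V_subset: "V \<subset> F"
    and zero: "0 \<in> V" and one: "1 \<in> V"
    and uminus: "x \<in> V \<Longrightarrow> - x \<in> V"
    and mult: "x \<in> V \<Longrightarrow> y \<in> V \<Longrightarrow> x * y \<in> V"
    and add: "x \<in> V \<Longrightarrow> y \<in> V \<Longrightarrow> x + y \<in> V"
    and dichotomy: "z \<in> F \<Longrightarrow> z \<noteq> 0 \<Longrightarrow> z \<in> V \<or> inverse z \<in> V"

lemma valuation_ring_iff:
  fixes V :: "'a::Fields.field set"
  shows "valuation_ring ring_of_type_algebra K F V \<longleftrightarrow> valuation K F V"
proof -
  interpret L: field "ring_of_type_algebra :: 'a ring" by (rule field_from_type_algebra)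
  have dich: "(\<forall>z\<in>F - {0}. z \<in> V \<or> inv\<^bsub>ring_of_type_algebra\<^esub> z \<in> V) \<longleftrightarrow>
      (\<forall>z. z \<in> F \<longrightarrow> z \<noteq> 0 \<longrightarrow> z \<in> V \<or> inverse z \<in> V)"
    by (auto simp: ring_of_type_algebra_inv)
  show ?thesis
  proof
    assume "valuation_ring ring_of_type_algebra K F V"
    note v = this[unfolded valuation_ring_def ring_of_type_algebra_sel dich]
    note subringE(2,3,5,6,7)[OF v[THEN conjunct1], simplified]
    with v[THEN conjunct2] show "valuation K F V" unfolding valuation_def by fast
  next
    assume "valuation K F V"
    then interpret valuation K F V .
    have "subring V ring_of_type_algebra"
      by (rule L.subringI) (use one uminus mult add in auto)
    then show "valuation_ring ring_of_type_algebra K F V"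
      unfolding valuation_ring_def ring_of_type_algebra_sel dich
      using K_subset V_subset dichotomy by simp
  qed
qed

text \<open>Closure of \<open>F\<close> under division allows the dichotomy to be applied to a
  quotient of two elements of \<open>V\<close>; this is what makes the nonunits additive.\<close>

locale valuation_on_field = valuation +
  assumes divide_in: "x \<in> F \<Longrightarrow> y \<in> F \<Longrightarrow> x / y \<in> F"
begin

lemma nonunits_subset: "nonunits V \<subseteq> V"
  by (auto simp: nonunits_def)

lemma one_not_nonunit: "1 \<notin> nonunits V"
  using one by (auto simp: nonunits_def)

lemma inverse_in: "z \<in> V \<Longrightarrow> z \<notin> nonunits V \<Longrightarrow> inverse z \<in> V"
  by (auto simp: nonunits_def)

lemma inverse_nonunit: "z \<in> F \<Longrightarrow> z \<notin> V \<Longrightarrow> inverse z \<in> nonunits V"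
  using dichotomy[of z] zero by (auto simp: nonunits_def)

lemma nonunits_mult:
  assumes "x \<in> nonunits V" "y \<in> V"
  shows "x * y \<in> nonunits V"
proof -
  have "inverse x \<in> V" if "inverse (x * y) \<in> V" "x * y \<noteq> 0"
    using mult[OF assms(2) that(1)] that(2) by (simp add: field_simps)
  then show ?thesis using assms mult by (auto simp: nonunits_def)
qed

lemma nonunits_prime:
  assumes "x \<in> V" "y \<in> V" "x * y \<in> nonunits V"
  shows "x \<in> nonunits V \<or> y \<in> nonunits V"
  using assms mult[of "inverse x" "inverse y"] by (auto simp: nonunits_def)

text \<open>One of \<open>x / y\<close> and \<open>y / x\<close> lies in \<open>V\<close>; factoring
  out the denominator writes the sum as a nonunit times an element of \<open>V\<close>.\<close>

lemma nonunits_add: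
  assumes "x \<in> nonunits V" "y \<in> nonunits V"
  shows "x + y \<in> nonunits V"
proof -
  have V: "x \<in> V" "y \<in> V" using assms nonunits_subset by auto
  have *: "x + y \<in> nonunits V" if xy: "x \<in> nonunits V" "y \<in> nonunits V" "x / y \<in> V" "y \<noteq> 0" for x y
  proof -
    have "x + y = y * (x / y + 1)" using xy by (simp add: field_simps)
    then show ?thesis using nonunits_mult[OF xy(2), of "x / y + 1"] xy(3) add one by simp
  qed
  show ?thesis
  proof (cases "x = 0 \<or> y = 0")
    case False
    then have "x / y \<in> F" using divide_in V V_subset by blast
    then have "x / y \<in> V \<or> y / x \<in> V" using dichotomy[of "x / y"] False by auto
    then show ?thesis using *[OF assms] *[OF assms(2,1)] False by (auto simp: add.commute)
  qed (use assms in auto)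
qed

lemma nonunits_uminus: "x \<in> nonunits V \<Longrightarrow> - x \<in> nonunits V"
  using nonunits_mult[of x "- 1"] uminus[OF one] by simp

lemma cring: "cring (ring_of_type_algebra\<lparr>carrier := V\<rparr>)"
  and ring: "ring (ring_of_type_algebra\<lparr>carrier := V\<rparr>)"
proof -
  interpret L: field "ring_of_type_algebra :: 'a ring" by (rule field_from_type_algebra)
  have "subring V ring_of_type_algebra"
    by (rule L.subringI) (use zero one uminus mult add in auto)
  then show "cring (ring_of_type_algebra\<lparr>carrier := V\<rparr>)"
    using L.subcringI' L.subcring_iff by force
  then show "ring (ring_of_type_algebra\<lparr>carrier := V\<rparr>)"
    by (simp add: cring_def)
qed

lemma ideal_nonunits: "ideal (nonunits V) (ring_of_type_algebra\<lparr>carrier := V\<rparr>)"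
proof (rule idealI)
  interpret R: ring "ring_of_type_algebra\<lparr>carrier := V\<rparr>" by (rule ring)
  show "ring (ring_of_type_algebra\<lparr>carrier := V\<rparr>)" by (rule ring)
  show "subgroup (nonunits V) (add_monoid (ring_of_type_algebra\<lparr>carrier := V\<rparr>))"
  proof (rule R.add.subgroupI)
    show "nonunits V \<noteq> {}" using zero by (auto simp: nonunits_def)
    fix x assume x: "x \<in> nonunits V"
    have "\<ominus>\<^bsub>ring_of_type_algebra\<lparr>carrier := V\<rparr>\<^esub> x = - x"
      by (rule R.minus_equality) (use x nonunits_subset uminus in auto)
    then show "\<ominus>\<^bsub>ring_of_type_algebra\<lparr>carrier := V\<rparr>\<^esub> x \<in> nonunits V"
      using nonunits_uminus x by simp
  qed (use nonunits_subset nonunits_add in auto)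
qed (use nonunits_mult in \<open>auto simp: mult.commute\<close>)

lemma ideal_subset_nonunits:
  assumes "ideal J (ring_of_type_algebra\<lparr>carrier := V\<rparr>)" "J \<noteq> V"
  shows "J \<subseteq> nonunits V"
proof
  interpret J: ideal J "ring_of_type_algebra\<lparr>carrier := V\<rparr>" by fact
  fix z assume z: "z \<in> J"
  then have "z \<in> V" using J.Icarr by simp
  show "z \<in> nonunits V"
  proof (rule ccontr)
    assume "z \<notin> nonunits V"
    then have *: "inverse z \<in> V" "z \<noteq> 0" using \<open>z \<in> V\<close> by (auto simp: nonunits_def)
    have "y \<in> J" if "y \<in> V" for y
    proof -
      have "z * (inverse z * y) \<in> J" using J.I_r_closed[OF z, of "inverse z * y"] mult * that by simp
      then show ?thesis using * by (simp flip: mult.assoc)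
    qed
    then show False using assms(2) J.a_subset by auto
  qed
qed

text \<open>All proper ideals consist of nonunits, and the nonunits form an ideal. The ideal in
  \<open>place\<close> thereby becomes a function of \<open>V\<close>, and ideals disappear from the
  later arguments.\<close>

lemma maximalideal_iff:
  "maximalideal P (ring_of_type_algebra\<lparr>carrier := V\<rparr>) \<longleftrightarrow> P = nonunits V"
proof
  assume P: "maximalideal P (ring_of_type_algebra\<lparr>carrier := V\<rparr>)"
  then interpret P: maximalideal P "ring_of_type_algebra\<lparr>carrier := V\<rparr>" .
  have "P \<noteq> V" using P.I_notcarr by auto
  then have "P \<subseteq> nonunits V" using ideal_subset_nonunits P.is_ideal by blast
  then have "nonunits V = P \<or> nonunits V = V"
    using P.I_maximal[OF ideal_nonunits] nonunits_subset by simp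
  then show "P = nonunits V" using one one_not_nonunit by auto
next
  assume P: "P = nonunits V"
  show "maximalideal P (ring_of_type_algebra\<lparr>carrier := V\<rparr>)"
    unfolding P
  proof (rule maximalidealI[OF ideal_nonunits])
    show "carrier (ring_of_type_algebra\<lparr>carrier := V\<rparr>) \<noteq> nonunits V"
      using one one_not_nonunit by auto
  qed (use ideal_subset_nonunits in auto)
qed

text \<open>The hypothesis says that the constants meet every residue class. The residue field is
  then the image of \<open>K\<close>, and a field has dimension 1 over itself.\<close>

lemma rational_placeI:
  assumes residue: "\<And>z. z \<in> V \<Longrightarrow> \<exists>c\<in>K. z - c \<in> nonunits V"
  shows "rational_place ring_of_type_algebra K F (nonunits V)"
proof -
  define A where "A = (ring_of_type_algebra\<lparr>carrier := V\<rparr> :: 'a ring)"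
  define R where "R = A Quot nonunits V"
  interpret A: cring A unfolding A_def by (rule cring)
  interpret P: ideal "nonunits V" A unfolding A_def by (rule ideal_nonunits)
  have max: "maximalideal (nonunits V) A" unfolding A_def by (simp add: maximalideal_iff)
  interpret R: field R unfolding R_def
    by (rule maximalideal.quotient_is_field[OF max]) unfold_locales
  have "carrier R = (\<lambda>c. nonunits V +>\<^bsub>A\<^esub> c) ` V"
    by (auto simp: R_def FactRing_def A_RCOSETS_def' A_def)
  also have "\<dots> = (\<lambda>c. nonunits V +>\<^bsub>A\<^esub> c) ` K"
  proof (intro equalityI subsetI)
    fix Z assume "Z \<in> (\<lambda>c. nonunits V +>\<^bsub>A\<^esub> c) ` V"
    then obtain z where z: "z \<in> V" "Z = nonunits V +>\<^bsub>A\<^esub> z" by auto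
    obtain c where c: "c \<in> K" "z - c \<in> nonunits V" using residue z by blast
    have "z = (z - c) \<oplus>\<^bsub>A\<^esub> c" by (simp add: A_def)
    then have "z \<in> nonunits V +>\<^bsub>A\<^esub> c" using c unfolding a_r_coset_def' by blast
    then have "nonunits V +>\<^bsub>A\<^esub> c = nonunits V +>\<^bsub>A\<^esub> z"
      using P.a_repr_independence'[of z c] K_subset c by (auto simp: A_def)
    then show "Z \<in> (\<lambda>c. nonunits V +>\<^bsub>A\<^esub> c) ` K" using c z by auto
  qed (use K_subset in auto)
  finally have dim: "R.dimension 1 ((\<lambda>c. nonunits V +>\<^bsub>A\<^esub> c) ` K) (carrier R)"
    using R.dimension_one[OF R.carrier_is_subfield] by simp
  show ?thesis
    unfolding rational_place_def Let_def
  proof (intro exI conjI)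
    show "valuation_ring ring_of_type_algebra K F V"
      by (simp add: valuation_ring_iff valuation_axioms)
    show "maximalideal (nonunits V) (ring_of_type_algebra\<lparr>carrier := V\<rparr>)"
      by (simp add: maximalideal_iff)
    show "ring.dimension (ring_of_type_algebra\<lparr>carrier := V\<rparr> Quot nonunits V) 1
        ((+>\<^bsub>ring_of_type_algebra\<lparr>carrier := V\<rparr>\<^esub>) (nonunits V) ` K)
        (carrier (ring_of_type_algebra\<lparr>carrier := V\<rparr> Quot nonunits V))"
      by (rule dim[unfolded R_def A_def])
  qed
qed

end

lemma place_iff:
  fixes F :: "'a::Fields.field set"
  assumes "\<And>x y. x \<in> F \<Longrightarrow> y \<in> F \<Longrightarrow> x / y \<in> F"
  shows "place ring_of_type_algebra K F P \<longleftrightarrow> (\<exists>V. valuation K F V \<and> P = nonunits V)"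
proof -
  have "valuation K F V \<and> maximalideal P (ring_of_type_algebra\<lparr>carrier := V\<rparr>) \<longleftrightarrow>
      valuation K F V \<and> P = nonunits V" for V
  proof (cases "valuation K F V")
    case True
    then have "valuation_on_field K F V"
      using assms by (simp add: valuation_on_field_def valuation_on_field_axioms_def)
    then show ?thesis by (simp add: valuation_on_field.maximalideal_iff)
  qed simp
  then show ?thesis by (simp add: place_def valuation_ring_iff)
qed

lemma rational_place_imp_place: "rational_place L K F P \<Longrightarrow> place L K F P"
  by (auto simp: rational_place_def place_def)

section \<open>Places of a rational function field\<close>

lemma subfield_gen_closed:
  shows subfield_gen_const: "const_fun c \<in> subfield_gen t"
    and subfield_gen_gen: "t \<in> subfield_gen t"
    and subfield_gen_0: "0 \<in> subfield_gen t"
    and subfield_gen_add: "y \<in> subfield_gen t \<Longrightarrow> z \<in> subfield_gen t \<Longrightarrow> y + z \<in> subfield_gen t"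
    and subfield_gen_mult: "y \<in> subfield_gen t \<Longrightarrow> z \<in> subfield_gen t \<Longrightarrow> y * z \<in> subfield_gen t"
    and subfield_gen_uminus: "y \<in> subfield_gen t \<Longrightarrow> - y \<in> subfield_gen t"
    and subfield_gen_divide: "y \<in> subfield_gen t \<Longrightarrow> z \<in> subfield_gen t \<Longrightarrow> y / z \<in> subfield_gen t"
proof -
  let ?L = "ratfun_field :: 'a poly fract ring"
  show const: "const_fun c \<in> subfield_gen t" for c
    unfolding subfield_gen_def by (intro generate_field.incl) simp
  from const[of 0] show zero: "0 \<in> subfield_gen t" by simp
  show "t \<in> subfield_gen t"
    unfolding subfield_gen_def by (intro generate_field.incl) simp
  show "y + z \<in> subfield_gen t" if "y \<in> subfield_gen t" "z \<in> subfield_gen t" for y z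
    using generate_field.eng_add[of y ?L _ z] that unfolding subfield_gen_def by simp
  show mult: "y * z \<in> subfield_gen t" if "y \<in> subfield_gen t" "z \<in> subfield_gen t" for y z
    using generate_field.eng_mult[of y ?L _ z] that unfolding subfield_gen_def by simp
  show "- y \<in> subfield_gen t" if "y \<in> subfield_gen t" for y
    using generate_field.a_inv[of y ?L] that unfolding subfield_gen_def by simp
  have inv: "inverse y \<in> subfield_gen t" if "y \<in> subfield_gen t" for y
  proof (cases "y = 0")
    case False
    then show ?thesis using generate_field.m_inv[of y ?L] that ring_of_type_algebra_inv[OF False]
      unfolding subfield_gen_def by simp
  qed (simp add: zero)
  show "y / z \<in> subfield_gen t" if "y \<in> subfield_gen t" "z \<in> subfield_gen t" for y z
    unfolding divide_inverse using mult inv that by blast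
qed

lemma subfield_gen_subfield: "subfield (subfield_gen t) ratfun_field"
proof -
  interpret field "ratfun_field :: 'a poly fract ring" by (rule field_from_type_algebra)
  show ?thesis unfolding subfield_gen_def by (rule generate_field_is_subfield) simp
qed

lemma poly_at_in_subfield_gen: "poly_at t u \<in> subfield_gen t"
  by (induction u)
    (auto intro: subfield_gen_0 subfield_gen_add subfield_gen_mult subfield_gen_const subfield_gen_gen)

text \<open>The quotients are closed under each rule of \<open>generate_field\<close>; transcendence
  of \<open>t\<close> keeps a nonzero denominator nonzero after substitution.\<close>

lemma subfield_gen_eq:
  assumes t: "t \<notin> constants"
  shows "subfield_gen t = {poly_at t u / poly_at t v | u v. v \<noteq> 0}" (is "_ = ?Q")
proof (intro equalityI subsetI)
  have QI: "z \<in> ?Q" if "z = poly_at t u / poly_at t v" "v \<noteq> 0" for z u v using that by blast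
  note nz = poly_at_eq_0_iff[OF t]
  fix z assume "z \<in> subfield_gen t"
  then show "z \<in> ?Q" unfolding subfield_gen_def
  proof (induction rule: generate_field.induct)
    case one
    show ?case by (rule QI[of _ 1 1]) simp_all
  next
    case (incl z)
    show ?case
    proof (cases "z = t")
      case True
      then show ?thesis by (intro QI[of _ "[:0, 1:]" 1]) simp_all
    next
      case False
      then obtain c where "z = const_fun c" using incl by (auto simp: constants_def)
      then show ?thesis by (intro QI[of _ "[:c:]" 1]) simp_all
    qed
  next
    case (a_inv z)
    then obtain u v where "z = poly_at t u / poly_at t v" "v \<noteq> 0" by blast
    then show ?case by (intro QI[of _ "- u" v]) simp_all
  next
    case (m_inv z)
    then obtain u v where z: "z = poly_at t u / poly_at t v" "v \<noteq> 0" by blast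
    with m_inv have "u \<noteq> 0" "z \<noteq> 0" by auto
    with z show ?case by (intro QI[of _ v u]) (simp_all add: ring_of_type_algebra_inv)
  next
    case (eng_add z1 z2)
    then obtain u v u' v' where "z1 = poly_at t u / poly_at t v" "v \<noteq> 0"
      "z2 = poly_at t u' / poly_at t v'" "v' \<noteq> 0" by blast
    then show ?case by (intro QI[of _ "u * v' + u' * v" "v * v'"]) (simp_all add: nz add_frac_eq)
  next
    case (eng_mult z1 z2)
    then obtain u v u' v' where "z1 = poly_at t u / poly_at t v" "v \<noteq> 0"
      "z2 = poly_at t u' / poly_at t v'" "v' \<noteq> 0" by blast
    then show ?case by (intro QI[of _ "u * u'" "v * v'"]) simp_all
  qed
qed (auto intro: subfield_gen_divide poly_at_in_subfield_gen)

lemma subfield_gen_coprime: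
  assumes t: "t \<notin> constants" and "z \<in> subfield_gen t"
  obtains u v where "z = poly_at t u / poly_at t v" "coprime u v" "v \<noteq> 0"
proof -
  from assms obtain u v where z: "z = poly_at t u / poly_at t v" "v \<noteq> 0"
    unfolding subfield_gen_eq[OF t] by blast
  obtain c u' v' where "coprime u' v'" "u = c * u'" "v = c * v'" "v' \<noteq> 0" "c \<noteq> 0"
    using poly_reduce_quotient[OF z(2)] .
  then show ?thesis using that[of u' v'] z by (simp add: poly_at_eq_0_iff[OF t])
qed

lemma place_subfield_gen_iff:
  "place ratfun_field constants (subfield_gen t) P \<longleftrightarrow>
    (\<exists>V. valuation constants (subfield_gen t) V \<and> P = nonunits V)"
  by (rule place_iff) (rule subfield_gen_divide)

lemma x_fun_nonconst: "x_fun \<notin> constants"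
  by (auto simp: constants_def x_fun_def const_fun_def)

lemma inverse_x_fun_nonconst: "inverse x_fun \<notin> constants"
proof
  assume "inverse (x_fun :: 'a poly fract) \<in> constants"
  then obtain c :: 'a where "inverse x_fun = const_fun c" by (auto simp: constants_def)
  then have "(x_fun :: 'a poly fract) = const_fun (inverse c)"
    by (metis inverse_const_fun inverse_inverse_eq)
  then show False using x_fun_nonconst by (metis const_fun_in_constants)
qed

lemma ratfun_quotient:
  fixes z :: "'a::field poly fract"
  obtains u v where "z = to_fract u / to_fract v" "coprime u v" "v \<noteq> 0"
proof -
  obtain u v where "num_denom z = (u, v)" by fastforce
  then show ?thesis using that[of u v] num_denom_props[of z u v] by blast
qed

lemma subfield_gen_x_fun: "subfield_gen x_fun = UNIV"
proof -
  have "z \<in> subfield_gen x_fun" for z :: "'a poly fract"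
    using ratfun_quotient[of z] poly_at_x_fun poly_at_in_subfield_gen subfield_gen_divide by metis
  then show ?thesis by blast
qed

lemma subfield_gen_inverse_x_fun: "subfield_gen (inverse x_fun) = UNIV"
proof -
  let ?S = "subfield_gen (inverse x_fun) :: 'a poly fract set"
  have "1 / inverse x_fun \<in> ?S"
    using subfield_gen_const[of 1] subfield_gen_gen by (intro subfield_gen_divide) simp_all
  then have x: "x_fun \<in> ?S" by (simp add: divide_inverse)
  have "poly_at x_fun u \<in> ?S" for u
    by (induction u) (auto intro: subfield_gen_0 subfield_gen_add subfield_gen_mult subfield_gen_const x)
  then have "z \<in> ?S" for z
    using ratfun_quotient[of z] subfield_gen_divide by (metis poly_at_x_fun)
  then show ?thesis by blast
qed

text \<open>The valuation ring and the place of \<open>k(t)\<close> belonging to an irreducible polynomial \<open>p\<close> in \<open>t\<close>.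
  For \<open>t = x\<close> these are the places of $k(x)$ other than the one at infinity, which is obtained
  from \<open>t = 1 / x\<close> and \<open>p = [:0, 1:]\<close>.\<close>

definition val_ring_at :: "'a::field poly fract \<Rightarrow> 'a poly \<Rightarrow> 'a poly fract set" where
  "val_ring_at t p = {poly_at t u / poly_at t v | u v. \<not> p dvd v}"

definition place_at :: "'a::field poly fract \<Rightarrow> 'a poly \<Rightarrow> 'a poly fract set" where
  "place_at t p = {poly_at t u / poly_at t v | u v. p dvd u \<and> \<not> p dvd v}"

lemma irreducible_poly_dvd_mult_iff:
  fixes p :: "'a::field poly"
  assumes "Factorial_Ring.irreducible p"
  shows "p dvd u * v \<longleftrightarrow> p dvd u \<or> p dvd v"
  by (rule prime_elem_dvd_mult_iff[OF field_poly_irreducible_imp_prime[OF assms]])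

lemma irreducible_not_dvd_coprime:
  fixes p :: "'a::field poly"
  assumes "Factorial_Ring.irreducible p" "coprime u v" "p dvd u"
  shows "\<not> p dvd v"
  using assms coprime_common_divisor[of u v p] irreducible_not_unit[of p] by blast

context
  fixes t :: "'a::field poly fract" and p :: "'a poly"
  assumes t: "t \<notin> constants" and p: "Factorial_Ring.irreducible p"
begin

private lemmas dvd_mult_iff_irreducible = irreducible_poly_dvd_mult_iff[OF p]
private lemmas not_dvd_both = irreducible_not_dvd_coprime[OF p]

lemma poly_at_divide_eq_iff:
  assumes "v \<noteq> 0" "v' \<noteq> 0"
  shows "poly_at t u / poly_at t v = poly_at t u' / poly_at t v' \<longleftrightarrow> u * v' = u' * v"
proof -
  have "poly_at t u / poly_at t v = poly_at t u' / poly_at t v' \<longleftrightarrow>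
      poly_at t (u * v') = poly_at t (u' * v)"
    using assms by (simp add: frac_eq_eq poly_at_eq_0_iff[OF t])
  then show ?thesis by (simp only: poly_at_eq_iff[OF t])
qed

text \<open>Membership allows any representation as a quotient; a coprime one decides it. If
  \<open>u * v' = u' * v\<close> with \<open>p\<close> not dividing \<open>v'\<close>, then
  \<open>p dvd v\<close> would force \<open>p dvd u\<close>.\<close>

lemma divide_in_val_ring_at_iff:
  assumes "coprime u v" "v \<noteq> 0"
  shows "poly_at t u / poly_at t v \<in> val_ring_at t p \<longleftrightarrow> \<not> p dvd v"
proof
  assume "poly_at t u / poly_at t v \<in> val_ring_at t p"
  then obtain u' v' where *: "poly_at t u / poly_at t v = poly_at t u' / poly_at t v'" "\<not> p dvd v'"
    unfolding val_ring_at_def by blast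
  moreover from this have "v' \<noteq> 0" by auto
  ultimately have "u * v' = u' * v" using assms poly_at_divide_eq_iff by blast
  then show "\<not> p dvd v"
    using * not_dvd_both assms dvd_mult_iff_irreducible by (metis coprime_commute)
qed (unfold val_ring_at_def, blast)

lemma divide_in_place_at_iff:
  assumes "coprime u v" "v \<noteq> 0"
  shows "poly_at t u / poly_at t v \<in> place_at t p \<longleftrightarrow> p dvd u"
proof
  assume "poly_at t u / poly_at t v \<in> place_at t p"
  then obtain u' v' where *: "poly_at t u / poly_at t v = poly_at t u' / poly_at t v'"
    "p dvd u'" "\<not> p dvd v'"
    unfolding place_at_def by blast
  moreover from this have "v' \<noteq> 0" by auto
  ultimately have "u * v' = u' * v" using assms poly_at_divide_eq_iff by blast
  then show "p dvd u"
    using * dvd_mult_iff_irreducible by metis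
qed (use not_dvd_both assms in \<open>unfold place_at_def, blast\<close>)

lemma poly_at_in_place_at_iff: "poly_at t u \<in> place_at t p \<longleftrightarrow> p dvd u"
  using divide_in_place_at_iff[of u 1] by simp

text \<open>The inclusions are strict because of \<open>poly_at t p\<close> and its inverse, and the
  dichotomy holds because \<open>p\<close> cannot divide both members of a coprime pair.\<close>

lemma valuation_val_ring_at: "valuation constants (subfield_gen t) (val_ring_at t p)"
proof
  have VI: "z \<in> val_ring_at t p" if "z = poly_at t u / poly_at t v" "\<not> p dvd v" for z u v
    using that unfolding val_ring_at_def by blast
  have p1: "\<not> p dvd 1" using p by (simp add: irreducible_not_unit)
  have pnz: "p \<noteq> 0" using p by auto
  note nz = poly_at_eq_0_iff[OF t]
  have "constants \<subseteq> val_ring_at t p"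
    using p1 by (auto simp: constants_def intro!: VI[of _ "[:_:]" 1])
  moreover have "poly_at t p \<in> val_ring_at t p" using p1 by (intro VI[of _ p 1]) simp_all
  moreover have "poly_at t p \<notin> constants"
  proof
    assume "poly_at t p \<in> constants"
    then obtain c where "poly_at t p = poly_at t [:c:]" by (auto simp: constants_def)
    then have "p = [:c:]" by (simp only: poly_at_eq_iff[OF t])
    then show False using irreducible_not_unit[OF p] pnz by (auto simp: is_unit_iff_degree)
  qed
  ultimately show "constants \<subset> val_ring_at t p" by blast
  have "val_ring_at t p \<subseteq> subfield_gen t"
    by (auto simp: val_ring_at_def intro: subfield_gen_divide poly_at_in_subfield_gen)
  moreover have "poly_at t 1 / poly_at t p \<in> subfield_gen t"
    by (intro subfield_gen_divide poly_at_in_subfield_gen)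
  moreover have "poly_at t 1 / poly_at t p \<notin> val_ring_at t p"
    using divide_in_val_ring_at_iff[of 1 p] pnz by auto
  ultimately show "val_ring_at t p \<subset> subfield_gen t" by blast
  show "0 \<in> val_ring_at t p" "1 \<in> val_ring_at t p"
    using p1 by (auto intro: VI[of _ 0 1] VI[of _ 1 1])
  fix y assume "y \<in> val_ring_at t p"
  then obtain u v where y: "y = poly_at t u / poly_at t v" "\<not> p dvd v"
    unfolding val_ring_at_def by blast
  then have v: "v \<noteq> 0" by auto
  show "- y \<in> val_ring_at t p" using y by (intro VI[of _ "- u" v]) simp_all
  fix z assume "z \<in> val_ring_at t p"
  then obtain u' v' where z: "z = poly_at t u' / poly_at t v'" "\<not> p dvd v'"
    unfolding val_ring_at_def by blast
  then have v': "v' \<noteq> 0" by auto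
  show "y * z \<in> val_ring_at t p"
    using y z by (intro VI[of _ "u * u'" "v * v'"]) (simp_all add: dvd_mult_iff_irreducible)
  show "y + z \<in> val_ring_at t p"
    using y z v v'
    by (intro VI[of _ "u * v' + u' * v" "v * v'"]) (simp_all add: dvd_mult_iff_irreducible nz add_frac_eq)
next
  fix z assume "z \<in> subfield_gen t" "z \<noteq> 0"
  then obtain u v where z: "z = poly_at t u / poly_at t v" "coprime u v" "v \<noteq> 0"
    using subfield_gen_coprime[OF t] by blast
  then have "u \<noteq> 0" using \<open>z \<noteq> 0\<close> by auto
  show "z \<in> val_ring_at t p \<or> inverse z \<in> val_ring_at t p"
    using divide_in_val_ring_at_iff[of u v] divide_in_val_ring_at_iff[of v u] z \<open>u \<noteq> 0\<close> not_dvd_both[of u v]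
    by (auto simp: coprime_commute)
qed

lemma nonunits_val_ring_at: "nonunits (val_ring_at t p) = place_at t p"
proof -
  have "z \<in> nonunits (val_ring_at t p) \<longleftrightarrow> z \<in> place_at t p" if z: "z \<in> subfield_gen t" for z
  proof -
    obtain u v where z: "z = poly_at t u / poly_at t v" "coprime u v" "v \<noteq> 0"
      using subfield_gen_coprime[OF t z] by blast
    show ?thesis
      using divide_in_val_ring_at_iff[of u v] divide_in_val_ring_at_iff[of v u]
        divide_in_place_at_iff[of u v] z not_dvd_both[of u v]
      by (cases "u = 0") (auto simp: coprime_commute nonunits_def poly_at_eq_0_iff[OF t])
  qed
  moreover have "nonunits (val_ring_at t p) \<subseteq> subfield_gen t" "place_at t p \<subseteq> subfield_gen t"
    by (auto simp: nonunits_def val_ring_at_def place_at_def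
        intro: subfield_gen_divide poly_at_in_subfield_gen)
  ultimately show ?thesis by blast
qed

lemma place_place_at: "place ratfun_field constants (subfield_gen t) (place_at t p)"
  unfolding place_subfield_gen_iff
  using valuation_val_ring_at nonunits_val_ring_at by blast

end

lemma valuation_on_subfield_gen:
  assumes "valuation constants (subfield_gen t) V"
  shows "valuation_on_field constants (subfield_gen t) V"
  by (intro valuation_on_field.intro valuation_on_field_axioms.intro assms subfield_gen_divide)

lemma monic_dvd_imp_eq:
  fixes p q :: "'a::field poly"
  assumes "p dvd q" "Factorial_Ring.irreducible q" "Factorial_Ring.irreducible p" "lead_coeff p = 1" "lead_coeff q = 1"
  shows "p = q"
proof -
  obtain r where r: "q = p * r" using assms(1) by (rule dvdE)
  then have "is_unit r" using assms(2,3) r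
      Factorial_Ring.irreducibleD[of q p r] irreducible_not_unit[of p] by blast
  then obtain c where c: "r = [:c:]" by (auto elim: is_unit_polyE)
  then have q: "q = smult c p" using r by simp
  then have "lead_coeff q = c * lead_coeff p" by (simp only: lead_coeff_smult)
  then have "c = 1" using assms(4,5) by (simp only: mult_1_right)
  then show ?thesis using q by simp
qed

text \<open>The place contracts to a nonzero prime ideal of $k[t]$, which is generated by \<open>p\<close>.\<close>

lemma place_classification:
  fixes t :: "'a::field poly fract"
  assumes t: "t \<notin> constants" and val: "valuation constants (subfield_gen t) V" and tV: "t \<in> V"
  obtains p where "Factorial_Ring.irreducible p" "lead_coeff p = 1" "nonunits V = place_at t p"
proof -
  interpret valuation_on_field constants "subfield_gen t" V
    by (rule valuation_on_subfield_gen[OF val])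
  have const: "const_fun c \<in> V" for c using K_subset by (auto simp: constants_def)
  have polyV: "poly_at t u \<in> V" for u
    by (induction u) (auto intro: zero add mult const tV)
  define I where "I = {u. poly_at t u \<in> nonunits V}"
  \<comment> \<open>If the contraction were zero, all nonzero elements of \<open>k[t]\<close> would
    be units of \<open>V\<close>, and \<open>V\<close> would be the whole field, against
    strictness.\<close>
  have "\<exists>u. u \<in> I \<and> u \<noteq> 0"
  proof (rule ccontr)
    assume *: "\<nexists>u. u \<in> I \<and> u \<noteq> 0"
    have "poly_at t u / poly_at t v \<in> V" if "v \<noteq> 0" for u v
    proof -
      have "poly_at t v \<notin> nonunits V" using * that by (auto simp: I_def)
      then show ?thesis unfolding divide_inverse by (intro mult polyV inverse_in)
    qed
    then have "subfield_gen t \<subseteq> V" unfolding subfield_gen_eq[OF t] by blast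
    then show False using V_subset by blast
  qed
  from ex_has_least_nat[of "\<lambda>u. u \<in> I \<and> u \<noteq> 0" _ degree] this
  obtain p0 where p0: "p0 \<in> I" "p0 \<noteq> 0"
    and least0: "\<And>u. u \<in> I \<Longrightarrow> u \<noteq> 0 \<Longrightarrow> degree p0 \<le> degree u"
    by metis
  \<comment> \<open>The monic normalization makes the generator unique, so that places can be
    counted by polynomials.\<close>
  define p where "p = smult (inverse (lead_coeff p0)) p0"
  have p: "p \<in> I" "p \<noteq> 0" "lead_coeff p = 1"
    using p0 nonunits_mult[OF _ const] by (auto simp: p_def I_def mult.commute)
  have least: "degree p \<le> degree u" if "u \<in> I" "u \<noteq> 0" for u
    using least0[OF that] p0 by (simp add: p_def)
  have I_iff: "u \<in> I \<longleftrightarrow> p dvd u" for u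
  proof
    assume "u \<in> I"
    then have "u + - (p * (u div p)) \<in> I"
      using p(1) polyV by (auto simp: I_def intro!: nonunits_add nonunits_uminus nonunits_mult simp del: add_uminus_conv_diff)
    then have "u mod p \<in> I" by (simp add: minus_mult_div_eq_mod)
    then show "p dvd u" using least[of "u mod p"] degree_mod_less[OF p(2), of u] by force
  next
    assume "p dvd u"
    then obtain r where "u = p * r" by (rule dvdE)
    then show "u \<in> I" using p(1) nonunits_mult[OF _ polyV, of "poly_at t p" r] by (simp add: I_def)
  qed
  have irr: "Factorial_Ring.irreducible p"
  proof (rule Factorial_Ring.irreducibleI)
    show "p \<noteq> 0" by (rule p(2))
    have "1 \<notin> I" using one_not_nonunit by (simp add: I_def)
    then show "\<not> is_unit p" by (simp add: I_iff)
    fix q r assume qr: "p = q * r"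
    then have "q \<in> I \<or> r \<in> I"
      using p(1) polyV nonunits_prime[of "poly_at t q" "poly_at t r"] by (auto simp: I_def)
    moreover have "q \<noteq> 0" "r \<noteq> 0" "degree p = degree q + degree r"
      using p(2) qr by (auto simp: degree_mult_eq)
    ultimately have "degree q = 0 \<or> degree r = 0" using least[of q] least[of r] by auto
    then show "is_unit q \<or> is_unit r" using \<open>q \<noteq> 0\<close> \<open>r \<noteq> 0\<close> by (simp add: is_unit_iff_degree)
  qed
  have inv: "inverse (poly_at t v) \<in> V" if "\<not> p dvd v" for v
    using that polyV inverse_in by (auto simp: I_def simp flip: I_iff)
  have sub: "place_at t p \<subseteq> nonunits V"
    using nonunits_mult inv by (auto simp: place_at_def I_def divide_inverse simp flip: I_iff)
  have "nonunits V \<subseteq> place_at t p"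
  proof
    fix z assume z: "z \<in> nonunits V"
    then have "z \<in> subfield_gen t" using nonunits_subset V_subset by blast
    then obtain u v where uv: "z = poly_at t u / poly_at t v" "coprime u v" "v \<noteq> 0"
      using subfield_gen_coprime[OF t] by blast
    \<comment> \<open>Otherwise \<open>inverse z\<close> would vanish at \<open>p\<close> and be a
      nonunit along with \<open>z\<close>, making their product 1 a nonunit.\<close>
    have "\<not> p dvd v"
    proof
      assume "p dvd v"
      then have nu: "\<not> p dvd u" using irreducible_not_dvd_coprime[OF irr] uv by (metis coprime_commute)
      then have "inverse z \<in> nonunits V" "z \<noteq> 0"
        using uv sub divide_in_place_at_iff[OF t irr, of v u] \<open>p dvd v\<close>
        by (auto simp: coprime_commute poly_at_eq_0_iff[OF t])
      then have "z * inverse z \<in> nonunits V" using z nonunits_mult nonunits_subset by blast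
      then show False using \<open>z \<noteq> 0\<close> one_not_nonunit by simp
    qed
    moreover have "poly_at t u = z * poly_at t v" using uv by (simp add: poly_at_eq_0_iff[OF t])
    then have "u \<in> I" using nonunits_mult[OF z polyV] by (simp add: I_def)
    ultimately show "z \<in> place_at t p" using uv I_iff unfolding place_at_def by blast
  qed
  with sub have "nonunits V = place_at t p" by blast
  then show ?thesis using that irr p(3) by blast
qed

lemma irreducible_linear: "Factorial_Ring.irreducible [:c, 1:: 'a::field:]"
  by (rule irreducible_linear_field_poly) simp

text \<open>A place containing \<open>t - b\<close> has \<open>t\<close> in its valuation ring, so
  the classification yields a monic irreducible \<open>p\<close> dividing the linear polynomial;
  this gives the uniqueness behind the definite description.\<close>

lemma place_t_eq:
  assumes t: "t \<notin> constants"
  shows "place_t t b = place_at t [:- b, 1:]"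
proof -
  let ?p = "[:- b, 1:]"
  let ?V = "val_ring_at t ?p"
  interpret valuation_on_field constants "subfield_gen t" ?V
    by (intro valuation_on_subfield_gen valuation_val_ring_at t irreducible_linear)
  have tb: "t - const_fun b = poly_at t ?p" by simp
  have nu: "nonunits ?V = place_at t ?p"
    by (intro nonunits_val_ring_at t irreducible_linear)
  have rat: "rational_place ratfun_field constants (subfield_gen t) (nonunits ?V)"
  proof (rule rational_placeI)
    fix z assume "z \<in> ?V"
    then obtain u v where z: "z = poly_at t u / poly_at t v" "\<not> ?p dvd v"
      unfolding val_ring_at_def by blast
    \<comment> \<open>The residue of \<open>z\<close> is its value at \<open>b\<close>:
      \<open>u - c v\<close> has the root \<open>b\<close>, so \<open>z - c\<close> lies in the
      place.\<close>
    define c where "c = poly u b / poly v b"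
    have "poly v b \<noteq> 0" using z(2) by (simp add: poly_eq_0_iff_dvd)
    then have "?p dvd u - smult c v" by (simp add: c_def flip: poly_eq_0_iff_dvd)
    moreover have "v \<noteq> 0" using z(2) by auto
    then have "z - const_fun c = poly_at t (u - smult c v) / poly_at t v"
      using z by (simp add: diff_divide_distrib poly_at_eq_0_iff[OF t])
    ultimately have "z - const_fun c \<in> nonunits ?V"
      using z(2) unfolding nu place_at_def by blast
    then show "\<exists>c\<in>constants. z - c \<in> nonunits ?V" by auto
  qed
  have mem: "t - const_fun b \<in> nonunits ?V"
    unfolding nu tb by (simp add: poly_at_in_place_at_iff[OF t irreducible_linear] del: poly_at_pCons)
  have uniq: "P = nonunits ?V"
    if P: "rational_place ratfun_field constants (subfield_gen t) P" "t - const_fun b \<in> P" for P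
  proof -
    obtain V where V: "valuation constants (subfield_gen t) V" "P = nonunits V"
      using rational_place_imp_place[OF P(1)] place_subfield_gen_iff by blast
    then interpret W: valuation_on_field constants "subfield_gen t" V
      by (simp add: valuation_on_subfield_gen)
    have "const_fun b \<in> V" using W.K_subset by (auto simp: constants_def)
    moreover have "t - const_fun b \<in> V" using P(2) V(2) W.nonunits_subset by blast
    ultimately have "t \<in> V" using W.add by fastforce
    then obtain p where p: "Factorial_Ring.irreducible p" "lead_coeff p = 1" "P = place_at t p"
      using place_classification[OF t V(1)] V(2) by metis
    then have "p dvd ?p" using P(2) poly_at_in_place_at_iff[OF t p(1), of ?p] unfolding tb by blast
    then have "p = ?p" by (rule monic_dvd_imp_eq) (use p in \<open>auto intro: irreducible_linear\<close>)
    then show ?thesis using p nu by simp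
  qed
  show ?thesis unfolding place_t_def the_rational_zero_def nu[symmetric]
    by (rule the_equality, rule conjI[OF rat mem], elim conjE, rule uniq)
qed

lemma place_x_eq: "place_x a = place_at x_fun [:- a, 1:]"
  using place_t_eq[OF x_fun_nonconst, of a] by (simp add: place_x_def place_t_def subfield_gen_x_fun)

section \<open>The degree of the extension\<close>

lemma combine_ring_of_type_algebra:
  fixes Ks Us :: "'a::Fields.field list"
  assumes "length Ks = length Us"
  shows "ring.combine ring_of_type_algebra Ks Us = (\<Sum>i<length Us. Ks ! i * Us ! i)"
proof -
  interpret field "ring_of_type_algebra :: 'a ring" by (rule field_from_type_algebra)
  show ?thesis using assms
    by (induction Ks Us rule: list_induct2) (simp_all add: sum.lessThan_Suc_shift del: sum.lessThan_Suc)
qed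

lemma to_fract_monom: "to_fract (monom c i) = const_fun c * x_fun ^ i"
proof (induction i)
  case 0
  show ?case by (simp add: monom_0 const_fun_def)
next
  case (Suc i)
  then show ?case using poly_at_pCons[of x_fun 0 "monom c i"] by (simp add: monom_Suc mult_ac del: poly_at_pCons)
qed

text \<open>Serves to turn a linear relation over \<open>k(t)\<close> into one over
  \<open>k[t]\<close>.\<close>

lemma common_denominator:
  fixes t :: "'a::field poly fract" and m :: nat
  assumes t: "t \<notin> constants" and "\<And>i. i < m \<Longrightarrow> c i \<in> subfield_gen t"
  shows "\<exists>v u. v \<noteq> 0 \<and> (\<forall>i<m. c i * poly_at t v = poly_at t (u i))"
  using assms(2)
proof (induction m)
  case 0
  show ?case by (intro exI[of _ 1]) simp
next
  case (Suc m)
  then obtain v u where IH: "v \<noteq> 0" "\<forall>i<m. c i * poly_at t v = poly_at t (u i)"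
    using less_Suc_eq by metis
  obtain u' v' where c: "c m = poly_at t u' / poly_at t v'" "v' \<noteq> 0"
    using Suc.prems[of m] subfield_gen_coprime[OF t] by blast
  have nz: "v * v' \<noteq> 0" using IH c by simp
  have eq: "c i * poly_at t (v * v') = poly_at t (if i = m then u' * v else u i * v')"
    if "i < Suc m" for i
  proof (cases "i = m")
    case True
    then show ?thesis using c by (simp add: poly_at_eq_0_iff[OF t])
  next
    case False
    then have "c i * poly_at t v = poly_at t (u i)" using that IH(2) by simp
    then show ?thesis using False by (simp flip: mult.assoc)
  qed
  show ?case
    by (intro exI[of _ "v * v'"] exI[of _ "\<lambda>i. if i = m then u' * v else u i * v'"]
        conjI allI impI nz eq)
qed

text \<open>After clearing denominators, the double sum in powers of \<open>x\<close> and
  \<open>t\<close> is regrouped by powers of \<open>t\<close>. The coefficients become polynomials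
  in \<open>x\<close> of degree below \<open>ratfun_degree t\<close>, and all of them
  vanish.\<close>

lemma powers_x_independent_sum:
  assumes t: "t \<notin> constants"
    and c: "\<And>i. i < ratfun_degree t \<Longrightarrow> c i \<in> subfield_gen t"
    and sum: "(\<Sum>i<ratfun_degree t. c i * x_fun ^ i) = 0"
    and "i < ratfun_degree t"
  shows "c i = 0"
proof -
  let ?d = "ratfun_degree t"
  obtain v u where v: "v \<noteq> 0" and u: "\<And>i. i < ?d \<Longrightarrow> c i * poly_at t v = poly_at t (u i)"
    using common_denominator[OF t, of ?d c] c by blast
  \<comment> \<open>Only a common bound for the degrees of the \<open>u i\<close>; the sum is a
    convenient substitute for the maximum.\<close>
  define n where "n = (\<Sum>i<?d. degree (u i))"
  have n: "degree (u i) \<le> n" if "i < ?d" for i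
    unfolding n_def using that by (intro member_le_sum) simp_all
  define A where "A j = (\<Sum>i<?d. monom (coeff (u i) j) i)" for j
  have degA: "degree (A j) < ?d" for j
    unfolding A_def using \<open>i < ?d\<close>
    by (intro degree_sum_less) (auto intro: le_less_trans[OF degree_monom_le])
  have "(\<Sum>j\<le>n. to_fract (A j) * t ^ j) =
      (\<Sum>j\<le>n. \<Sum>i<?d. const_fun (coeff (u i) j) * t ^ j * x_fun ^ i)"
    by (simp add: A_def to_fract_monom sum_distrib_left sum_distrib_right mult_ac)
  also have "\<dots> = (\<Sum>i<?d. poly_at t (u i) * x_fun ^ i)"
    by (subst sum.swap) (auto simp: poly_at_altdef[OF n] sum_distrib_right intro!: sum.cong)
  also have "\<dots> = (\<Sum>i<?d. poly_at t v * (c i * x_fun ^ i))"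
    by (intro sum.cong) (auto simp flip: u)
  also have "\<dots> = 0" unfolding sum_distrib_left[symmetric] sum by simp
  finally have A0: "A j = 0" if "j \<le> n" for j
    using sum_to_fract_mult_power_zero[of n A t j] degA that by blast
  have "coeff (u i) j = 0" for j
  proof (cases "j \<le> n")
    case True
    have "coeff (A j) i = coeff (u i) j"
      using \<open>i < ?d\<close> by (simp add: A_def coeff_sum)
    then show ?thesis using A0[OF True] by simp
  next
    case False
    then show ?thesis using n[OF \<open>i < ?d\<close>] by (intro coeff_eq_0) simp
  qed
  then have "u i = 0" by (intro poly_eqI) simp
  then show ?thesis using u[OF \<open>i < ?d\<close>] v by (simp add: poly_at_eq_0_iff[OF t])
qed

text \<open>\<open>x\<close> is a root of $f(X) - t g(X)$, whose leading coefficient is nonzero as \<open>t\<close> is not constant.\<close>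

lemma x_power_degree:
  fixes t :: "'a::field poly fract"
  assumes t: "t \<notin> constants"
  obtains e where "\<And>i. e i \<in> subfield_gen t"
    "x_fun ^ ratfun_degree t = (\<Sum>i<ratfun_degree t. e i * x_fun ^ i)"
proof -
  let ?d = "ratfun_degree t"
  obtain f g where fg: "num_denom t = (f, g)" by fastforce
  note nd = num_denom_props[OF fg]
  have d: "?d = max (degree f) (degree g)" by (simp add: ratfun_degree_def fg)
  define l where "l i = const_fun (coeff f i) - t * const_fun (coeff g i)" for i
  have l_in: "l i \<in> subfield_gen t" for i
    unfolding l_def diff_conv_add_uminus
    by (intro subfield_gen_add subfield_gen_uminus subfield_gen_mult subfield_gen_const subfield_gen_gen)
  have "(\<Sum>i\<le>?d. l i * x_fun ^ i) = poly_at x_fun f - t * poly_at x_fun g"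
    using d by (simp add: l_def poly_at_altdef[of _ ?d] algebra_simps sum_subtractf sum_distrib_left
        del: poly_at_x_fun)
  also have "\<dots> = 0" using nd by simp
  finally have sum: "(\<Sum>i<?d. l i * x_fun ^ i) + l ?d * x_fun ^ ?d = 0"
    by (simp flip: lessThan_Suc_atMost)
  have "l ?d \<noteq> 0"
  proof
    assume l0: "l ?d = 0"
    show False
    proof (cases "coeff g ?d = 0")
      case True
      then have "coeff f ?d = 0" using l0 by (simp add: l_def)
      then have "degree f < ?d \<or> f = 0" "degree g < ?d \<or> g = 0" using True d
        by (metis leading_coeff_0_iff max.cobounded1 le_neq_implies_less,
            metis leading_coeff_0_iff True max.cobounded2 le_neq_implies_less)
      then show False using d nd(2) ratfun_degree_pos[OF t] by (auto simp: max_def split: if_splits)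
    next
      case False
      then have "t = const_fun (coeff f ?d) * inverse (const_fun (coeff g ?d))"
        using l0 by (simp add: l_def field_simps)
      then show False using t unfolding inverse_const_fun
        by (metis const_fun_in_constants const_fun_simps(4))
    qed
  qed
  then have "x_fun ^ ?d = - (\<Sum>i<?d. l i * x_fun ^ i) / l ?d"
    using sum by (simp add: field_simps eq_neg_iff_add_eq_0)
  also have "\<dots> = (\<Sum>i<?d. (- l i / l ?d) * x_fun ^ i)"
    by (simp add: sum_divide_distrib sum_negf)
  finally show ?thesis
    using that[of "\<lambda>i. - l i / l ?d"] l_in subfield_gen_divide subfield_gen_uminus by blast
qed

text \<open>The span \<open>W\<close> of the powers of \<open>x\<close> below the degree is closed
  under multiplication by \<open>x\<close>, so it contains \<open>k(t)[x]\<close>. Being of finite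
  dimension over \<open>k(t)\<close>, that ring is a field; it contains the constants and
  \<open>x\<close>, hence equals \<open>k(x)\<close>.\<close>

lemma dimension_ratfun_field:
  fixes t :: "'a::field poly fract"
  assumes t: "t \<notin> constants"
  shows "ring.dimension ratfun_field (ratfun_degree t) (subfield_gen t) UNIV"
proof -
  let ?L = "ratfun_field :: 'a poly fract ring"
  let ?K = "subfield_gen t"
  let ?d = "ratfun_degree t"
  define Us where "Us = map (\<lambda>i. x_fun ^ i :: 'a poly fract) [0..<?d]"
  interpret L: field ?L by (rule field_from_type_algebra)
  note sub = subfield_gen_subfield[of t]
  have carr: "set Us \<subseteq> carrier ?L" by simp
  have len: "length Us = ?d" by (simp add: Us_def)
  have comb: "L.combine Ks Us = (\<Sum>i<?d. Ks ! i * x_fun ^ i)" if "length Ks = length Us" for Ks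
    using combine_ring_of_type_algebra[OF that] by (simp add: Us_def)
  have indep: "L.independent ?K Us"
  proof (rule L.trivial_combine_imp_independent[OF sub carr])
    fix Ks assume Ks: "set Ks \<subseteq> ?K" "L.combine Ks Us = \<zero>\<^bsub>?L\<^esub>"
    \<comment> \<open>The independence criterion admits coefficient lists of any length; they are
      truncated or padded with zeros to the length of \<open>Us\<close>.\<close>
    obtain Ks' where Ks': "set (take (length Us) Ks) \<subseteq> set Ks'"
      "set Ks' \<subseteq> set (take (length Us) Ks) \<union> {\<zero>\<^bsub>?L\<^esub>}"
      "length Ks' = length Us" "L.combine Ks' Us = \<zero>\<^bsub>?L\<^esub>"
      using L.combine_normalize[of Ks Us "\<zero>\<^bsub>?L\<^esub>"] Ks carr by auto
    have "set Ks' \<subseteq> ?K"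
      using Ks'(2) Ks(1) set_take_subset[of "length Us" Ks] subfield_gen_0[of t] by auto
    then have "Ks' ! i \<in> ?K" if "i < ?d" for i using that Ks'(3) len by auto
    then have "Ks' ! i = 0" if "i < ?d" for i
      using powers_x_independent_sum[OF t, of "\<lambda>i. Ks' ! i" i] that Ks'(3,4) comb by auto
    then have "set Ks' \<subseteq> {\<zero>\<^bsub>?L\<^esub>}" using Ks'(3) len by (auto simp: in_set_conv_nth)
    then show "set (take (length Us) Ks) \<subseteq> {\<zero>\<^bsub>?L\<^esub>}" using Ks'(1) by blast
  qed
  define W where "W = L.Span ?K Us"
  note W_simps = L.Span_subgroup_props[OF sub carr, folded W_def]
    L.Span_smult_closed[OF sub carr, folded W_def]
  have W_0: "0 \<in> W" using W_simps(2) by simp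
  have W_add: "v + w \<in> W" if "v \<in> W" "w \<in> W" for v w
    using W_simps(3)[OF that] by simp
  have W_smult: "k * w \<in> W" if "k \<in> ?K" "w \<in> W" for k w
    using W_simps(5)[OF that] by simp
  have W_sum: "(\<Sum>i\<in>I. k i * w i) \<in> W" if "\<And>i. i \<in> I \<Longrightarrow> k i \<in> ?K \<and> w i \<in> W" for I :: "nat set" and k w
    using that by (induction I rule: infinite_finite_induct) (auto intro: W_0 W_add W_smult)
  have W_pow: "x_fun ^ i \<in> W" if "i < ?d" for i
    using L.Span_base_incl[OF sub carr, folded W_def] that by (auto simp: Us_def)
  have W_pow_d: "x_fun ^ ?d \<in> W"
  proof -
    obtain e where "\<And>i. e i \<in> ?K" "x_fun ^ ?d = (\<Sum>i<?d. e i * x_fun ^ i)"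
      using x_power_degree[OF t] by blast
    then show ?thesis using W_pow by (auto intro: W_sum)
  qed
  have W_x: "w * x_fun \<in> W" if "w \<in> W" for w
  proof -
    from that obtain Ks where Ks: "set Ks \<subseteq> ?K" "length Ks = length Us" "w = L.combine Ks Us"
      using L.Span_mem_iff_length_version[OF sub carr, folded W_def] by auto
    have "w * x_fun = (\<Sum>i<?d. Ks ! i * x_fun ^ Suc i)"
      unfolding Ks(3) comb[OF Ks(2)] sum_distrib_right by (simp add: mult_ac)
    moreover have "x_fun ^ Suc i \<in> W" if "i < ?d" for i
      using that W_pow W_pow_d by (cases "Suc i = ?d") (auto simp del: power_Suc)
    ultimately show ?thesis
      using W_sum[of "{..<?d}"] Ks(1,2) len by (auto simp del: power_Suc simp: subset_iff)
  qed
  let ?S = "L.simple_extension ?K x_fun"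
  have "?S \<subseteq> W"
  proof
    fix s assume "s \<in> ?S"
    then show "s \<in> W"
    proof (induction rule: L.simple_extension.induct)
      case zero
      then show ?case using W_0 by simp
    next
      case (lin k1 k2)
      \<comment> \<open>The constant term needs 1 in \<open>W\<close>, that is, a positive
        degree.\<close>
      have "k2 * x_fun ^ 0 \<in> W" using lin W_pow ratfun_degree_pos[OF t] by (intro W_smult)
      then show ?case using W_add[OF W_x[OF lin.IH]] by simp
    qed
  qed
  have subK: "subring ?K ?L" using subfieldE(1)[OF sub] .
  have ringS: "subring ?S ?L" by (rule L.simple_extension_is_subring[OF subK]) simp
  have KS: "?K \<subseteq> ?S" by (rule L.simple_extension_incl) simp_all
  have "subalgebra ?K ?S ?L"
    unfolding subalgebra_def subalgebra_axioms_def
    using subring.axioms(1)[OF ringS] subringE(6)[OF ringS] KS by blast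
  then have "L.finite_dimension ?K ?S"
    using L.subalbegra_incl_imp_finite_dimension[OF sub L.Span_finite_dimension[OF sub carr, folded W_def]] \<open>?S \<subseteq> W\<close>
    by blast
  then have "subfield ?S ?L"
    using L.finite_dimension_simple_extension[OF sub] L.simple_extension_is_subfield[OF sub] by simp
  moreover have "constants \<union> {x_fun} \<subseteq> ?S"
    using KS subfield_gen_const L.simple_extension_mem[OF subK, of x_fun] by (auto simp: constants_def)
  ultimately have "subfield_gen x_fun \<subseteq> ?S"
    unfolding subfield_gen_def by (intro L.generate_field_min_subfield1) simp_all
  then have "W = UNIV" using \<open>?S \<subseteq> W\<close> subfield_gen_x_fun by blast
  then show ?thesis using L.dimension_independent[OF indep, folded W_def] len by metis
qed

section \<open>Places over a rational place\<close>

text \<open>If \<open>t - b\<close> lies in \<open>P\<close>, then \<open>k[t]\<close> lies in the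
  valuation ring \<open>V\<close> of \<open>P\<close>. A polynomial \<open>v\<close> with
  \<open>v(b)\<close> nonzero is congruent modulo \<open>P\<close> to the unit \<open>v(b)\<close>,
  so its value at \<open>t\<close> is a unit of \<open>V\<close>; hence all of \<open>P_b\<close>
  lies in \<open>P\<close>.\<close>

lemma lies_over_place_t_iff:
  assumes t: "t \<notin> constants"
  shows "lies_over ratfun_field constants UNIV (subfield_gen t) P (place_t t b) \<longleftrightarrow>
    place ratfun_field constants UNIV P \<and> t - const_fun b \<in> P"
proof -
  let ?p = "[:- b, 1:]"
  have tb: "t - const_fun b = poly_at t ?p" by simp
  have "t - const_fun b \<in> place_at t ?p"
    unfolding tb by (simp only: poly_at_in_place_at_iff[OF t irreducible_linear] dvd_refl)
  moreover have "place_at t ?p \<subseteq> P" if P: "place ratfun_field constants UNIV P" "t - const_fun b \<in> P"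
  proof -
    obtain V where V: "valuation constants UNIV V" "P = nonunits V"
      using P(1) place_iff[of UNIV constants P] by auto
    interpret valuation_on_field constants UNIV V
      using V(1) by (simp add: valuation_on_field_def valuation_on_field_axioms_def)
    have const: "const_fun c \<in> V" for c using K_subset by (auto simp: constants_def)
    have "t - const_fun b \<in> V" using P(2) V(2) nonunits_subset by blast
    from add[OF this const[of b]] have "t \<in> V" by simp
    then have polyV: "poly_at t u \<in> V" for u
      by (induction u) (auto intro: zero add mult const)
    have dvd: "poly_at t u \<in> nonunits V" if u: "?p dvd u" for u
    proof -
      from u obtain r where "u = ?p * r" by (rule dvdE)
      then have "poly_at t u = (t - const_fun b) * poly_at t r" unfolding tb by (simp only: poly_at_mult)
      then show ?thesis using nonunits_mult polyV P(2) V(2) by metis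
    qed
    have "inverse (poly_at t v) \<in> V" if v: "\<not> ?p dvd v" for v
    proof (rule inverse_in[OF polyV])
      have pv: "poly v b \<noteq> 0" using v by (simp add: poly_eq_0_iff_dvd)
      have "?p dvd v - [:poly v b:]" by (simp flip: poly_eq_0_iff_dvd)
      then have *: "poly_at t v - const_fun (poly v b) \<in> nonunits V"
        using dvd[of "v - [:poly v b:]"] by simp
      show "poly_at t v \<notin> nonunits V"
      proof
        assume "poly_at t v \<in> nonunits V"
        then have "poly_at t v + - (poly_at t v - const_fun (poly v b)) \<in> nonunits V"
          using * by (intro nonunits_add nonunits_uminus)
        then have "const_fun (poly v b) * const_fun (inverse (poly v b)) \<in> nonunits V"
          using const by (intro nonunits_mult) simp_all
        then have "const_fun 1 \<in> nonunits V" using pv unfolding const_fun_simps(4)[symmetric] by simp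
        then show False using one_not_nonunit by simp
      qed
    qed
    then show "place_at t ?p \<subseteq> P"
      unfolding place_at_def V(2) divide_inverse using dvd nonunits_mult by blast
  qed
  ultimately show ?thesis
    unfolding lies_over_def place_t_eq[OF t] using place_place_at[OF t irreducible_linear] by blast
qed

section \<open>All places of \<open>k(x)\<close>, and the zeros of a quotient at each of
  them\<close>

definition place_infinity :: "'a::field poly fract set" where
  "place_infinity = place_at (inverse x_fun) [:0, 1:]"

lemma irreducible_X: "Factorial_Ring.irreducible [:0, 1 :: 'a::field:]"
  by (rule irreducible_linear)

text \<open>If \<open>x\<close> is not in the valuation ring, \<open>1 / x\<close> is a nonunit; the
  classification in \<open>1 / x\<close> then gives a monic irreducible polynomial dividing the
  variable.\<close>

lemma place_ratfun_iff:
  "place ratfun_field constants UNIV P \<longleftrightarrow>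
    (\<exists>p. Factorial_Ring.irreducible p \<and> lead_coeff p = 1 \<and> P = place_at x_fun p) \<or> P = place_infinity"
proof
  assume "place ratfun_field constants UNIV P"
  then obtain V where V: "valuation constants UNIV V" "P = nonunits V"
    using place_iff[of UNIV constants P] by auto
  interpret valuation_on_field constants UNIV V
    using V(1) by (simp add: valuation_on_field_def valuation_on_field_axioms_def)
  show "(\<exists>p. Factorial_Ring.irreducible p \<and> lead_coeff p = 1 \<and> P = place_at x_fun p) \<or> P = place_infinity"
  proof (cases "x_fun \<in> V")
    case True
    then show ?thesis
      using place_classification[OF x_fun_nonconst, of V] V unfolding subfield_gen_x_fun by metis
  next
    case False
    then have inv: "inverse x_fun \<in> nonunits V" using inverse_nonunit by simp
    then have "inverse x_fun \<in> V" using nonunits_subset by blast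
    then obtain p where p: "Factorial_Ring.irreducible p" "lead_coeff p = 1"
      "nonunits V = place_at (inverse x_fun) p"
      using place_classification[OF inverse_x_fun_nonconst, of V] V(1)
      unfolding subfield_gen_inverse_x_fun by metis
    have "inverse x_fun = poly_at (inverse x_fun) [:0, 1:]" by simp
    then have "poly_at (inverse x_fun) [:0, 1:] \<in> place_at (inverse x_fun) p"
      using inv p(3) by metis
    then have "p dvd [:0, 1:]"
      unfolding poly_at_in_place_at_iff[OF inverse_x_fun_nonconst p(1)] .
    then have "p = [:0, 1:]" by (rule monic_dvd_imp_eq) (use p irreducible_X in auto)
    then show ?thesis using p V(2) by (simp add: place_infinity_def)
  qed
next
  assume "(\<exists>p. Factorial_Ring.irreducible p \<and> lead_coeff p = 1 \<and> P = place_at x_fun p) \<or> P = place_infinity"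
  then show "place ratfun_field constants UNIV P"
    using place_place_at[OF x_fun_nonconst] place_place_at[OF inverse_x_fun_nonconst irreducible_X]
    unfolding subfield_gen_x_fun subfield_gen_inverse_x_fun place_infinity_def by blast
qed

text \<open>For nonzero \<open>u\<close> the reversed polynomial has nonzero constant term, so its
  value at \<open>1 / x\<close> is a unit at infinity and the order of \<open>u\<close> there is
  read off from the power of \<open>x\<close>.\<close>

lemma to_fract_eq_power_mult_reflect:
  "to_fract u = x_fun ^ degree u * poly_at (inverse x_fun) (reflect_poly u)"
proof -
  have x: "(x_fun :: 'a poly fract) \<noteq> 0" by (simp add: x_fun_def)
  have "poly_at (inverse x_fun) (reflect_poly u) =
      (\<Sum>j\<le>degree u. const_fun (coeff u (degree u - j)) * inverse x_fun ^ j)"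
    by (simp add: poly_at_altdef[OF degree_reflect_poly_le] coeff_reflect_poly)
  also have "\<dots> = (\<Sum>j\<le>degree u. const_fun (coeff u j) * inverse x_fun ^ (degree u - j))"
    by (rule sum.reindex_bij_witness[of _ "\<lambda>j. degree u - j" "\<lambda>j. degree u - j"]) auto
  also have "x_fun ^ degree u * \<dots> = (\<Sum>j\<le>degree u. const_fun (coeff u j) * x_fun ^ j)"
    unfolding sum_distrib_left
  proof (rule sum.cong)
    fix j assume "j \<in> {..degree u}"
    then have "x_fun ^ degree u * inverse x_fun ^ (degree u - j) = (x_fun :: 'a poly fract) ^ j"
      using x power_add[of "x_fun :: 'a poly fract" j "degree u - j"] by (simp add: power_inverse field_simps)
    then show "x_fun ^ degree u * (const_fun (coeff u j) * inverse x_fun ^ (degree u - j)) =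
        const_fun (coeff u j) * x_fun ^ j"
      by (metis mult.left_commute)
  qed simp
  also have "\<dots> = poly_at x_fun u" by (rule poly_at_altdef[OF order_refl, symmetric])
  finally show ?thesis by simp
qed

lemma divide_in_place_infinity_iff:
  fixes u v :: "'a::field poly"
  assumes "u \<noteq> 0" "v \<noteq> 0"
  shows "to_fract u / to_fract v \<in> place_infinity \<longleftrightarrow> degree u < degree v"
proof -
  let ?X = "[:0, 1 :: 'a:]"
  let ?y = "inverse x_fun :: 'a poly fract"
  have x: "(x_fun :: 'a poly fract) \<noteq> 0" by (simp add: x_fun_def)
  have unit: "\<not> ?X dvd reflect_poly w" if "w \<noteq> 0" for w
    using that by (simp add: poly_0_coeff_0 reflect_poly_at_0_eq_0_iff flip: poly_eq_0_iff_dvd[of _ 0, simplified])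
  have small: "to_fract u / to_fract v \<in> place_infinity" if "u \<noteq> 0" "v \<noteq> 0" "degree u < degree v" for u v :: "'a poly"
  proof -
    have "degree v = degree u + (degree v - degree u)" using that by simp
    then have "x_fun ^ degree u / x_fun ^ degree v = ?y ^ (degree v - degree u)"
      using x power_add[of "x_fun :: 'a poly fract" "degree u" "degree v - degree u"]
      by (simp add: field_simps power_inverse)
    moreover have "?y ^ k = poly_at ?y (?X ^ k)" for k by (induction k) simp_all
    ultimately have "to_fract u / to_fract v =
        poly_at ?y (?X ^ (degree v - degree u) * reflect_poly u) / poly_at ?y (reflect_poly v)"
      unfolding to_fract_eq_power_mult_reflect[of u] to_fract_eq_power_mult_reflect[of v]
      by (simp flip: times_divide_times_eq)
    moreover have "?X dvd ?X ^ (degree v - degree u) * reflect_poly u"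
      using that(3) by (intro dvd_mult2 dvd_power) simp
    ultimately show ?thesis
      unfolding place_infinity_def place_at_def using unit[OF that(2)] by blast
  qed
  have large: "to_fract u / to_fract v \<notin> place_infinity" if "degree v \<le> degree u"
  proof -
    interpret V: valuation_on_field constants UNIV "val_ring_at ?y ?X"
      using valuation_on_subfield_gen[OF valuation_val_ring_at[OF inverse_x_fun_nonconst irreducible_X]]
      unfolding subfield_gen_inverse_x_fun .
    have nu: "nonunits (val_ring_at ?y ?X) = place_infinity"
      unfolding place_infinity_def
      by (rule nonunits_val_ring_at[OF inverse_x_fun_nonconst irreducible_X])
    \<comment> \<open>The reciprocal is integral at infinity: by \<open>small\<close> with the roles
      exchanged, or as a quotient of two units when the degrees agree.\<close>
    have "to_fract v / to_fract u \<in> val_ring_at ?y ?X"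
    proof (cases "degree v < degree u")
      case True
      then show ?thesis using small[of v u] assms nu V.nonunits_subset by blast
    next
      case False
      then have "degree u = degree v" using that by simp
      then have "to_fract v / to_fract u = poly_at ?y (reflect_poly v) / poly_at ?y (reflect_poly u)"
        using x unfolding to_fract_eq_power_mult_reflect[of u] to_fract_eq_power_mult_reflect[of v]
        by simp
      then show ?thesis unfolding val_ring_at_def using unit[OF assms(1)] by blast
    qed
    then show ?thesis using assms unfolding nu[symmetric] nonunits_def by simp
  qed
  show ?thesis using small[OF assms] large by fastforce
qed

lemma divide_in_place_at_x_fun_iff:
  assumes "Factorial_Ring.irreducible p" "coprime u v" "v \<noteq> 0"
  shows "to_fract u / to_fract v \<in> place_at x_fun p \<longleftrightarrow> p dvd u"
  using divide_in_place_at_iff[OF x_fun_nonconst assms] by simp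

text \<open>\<open>1 / x\<close> separates them: it vanishes at infinity, but no irreducible
  polynomial divides its numerator 1.\<close>

lemma place_at_x_fun_neq_infinity:
  fixes p :: "'a::field poly"
  assumes p: "Factorial_Ring.irreducible p"
  shows "place_at x_fun p \<noteq> place_infinity"
proof
  assume eq: "place_at x_fun p = place_infinity"
  have "to_fract 1 / to_fract [:0, 1 :: 'a:] \<in> place_infinity"
    by (subst divide_in_place_infinity_iff) simp_all
  then have "p dvd 1"
    using divide_in_place_at_x_fun_iff[OF p, of 1 "[:0, 1:]"] unfolding eq by simp
  then show False using irreducible_not_unit[OF p] by simp
qed

lemma place_at_x_fun_inj:
  assumes "Factorial_Ring.irreducible p" "Factorial_Ring.irreducible q" "lead_coeff p = 1" "lead_coeff q = 1"
    and "place_at x_fun p = place_at x_fun q"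
  shows "p = q"
proof -
  have "poly_at x_fun q \<in> place_at x_fun q"
    by (simp only: poly_at_in_place_at_iff[OF x_fun_nonconst assms(2)] dvd_refl)
  then have "p dvd q"
    unfolding assms(5)[symmetric] poly_at_in_place_at_iff[OF x_fun_nonconst assms(1)] .
  then show ?thesis using monic_dvd_imp_eq assms by blast
qed

section \<open>Roots and monic irreducible divisors of a polynomial\<close>

lemma irreducible_poly_dvd_prod:
  fixes p :: "'a::field poly"
  assumes "Factorial_Ring.irreducible p" "finite S" "p dvd \<Prod>S"
  shows "\<exists>q\<in>S. p dvd q"
  using assms(2,3)
proof (induction S rule: finite_induct)
  case empty
  then show ?case using irreducible_not_unit[OF assms(1)] by simp
next
  case (insert q S)
  then show ?case using irreducible_poly_dvd_mult_iff[OF assms(1)] by auto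
qed

lemma prod_monic_irreducible_dvd:
  fixes u :: "'a::field poly"
  assumes "finite S"
    and "\<And>p. p \<in> S \<Longrightarrow> Factorial_Ring.irreducible p \<and> lead_coeff p = 1 \<and> p dvd u"
  shows "\<Prod>S dvd u"
  using assms
proof (induction S rule: finite_induct)
  case (insert p S)
  then have "\<Prod>S dvd u" by simp
  then obtain r where r: "u = \<Prod>S * r" by (rule dvdE)
  have p: "Factorial_Ring.irreducible p" "lead_coeff p = 1" "p dvd u" using insert.prems by auto
  have "\<not> p dvd \<Prod>S"
  proof
    assume "p dvd \<Prod>S"
    then obtain q where q: "q \<in> S" "p dvd q"
      using irreducible_poly_dvd_prod[OF p(1) insert.hyps(1)] by blast
    then have "p = q" using monic_dvd_imp_eq p insert.prems by blast
    then show False using q insert.hyps by simp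
  qed
  then have "p dvd r" using p(3) unfolding r irreducible_poly_dvd_mult_iff[OF p(1)] by blast
  then show ?case using insert.hyps unfolding r by (simp add: mult.commute mult_dvd_mono)
qed simp

text \<open>Distinct monic irreducible divisors have a product that still divides \<open>u\<close>,
  so their degrees, each at least 1, add up to at most \<open>degree u\<close>. Equality of the
  count with \<open>degree u\<close> forces every divisor to be linear and so to come from a
  root.\<close>

lemma monic_irreducible_divisors:
  fixes u :: "'a::field poly"
  assumes "u \<noteq> 0"
  defines "S \<equiv> {p. Factorial_Ring.irreducible p \<and> lead_coeff p = 1 \<and> p dvd u}"
  shows finite_monic_irreducible_divisors: "finite S"
    and card_roots_le: "card {a. poly u a = 0} \<le> card S"
    and card_monic_irreducible_divisors_le: "card S \<le> degree u"
    and card_roots_eq: "card S = degree u \<Longrightarrow> card {a. poly u a = 0} = card S"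
proof -
  have S: "Factorial_Ring.irreducible p" "lead_coeff p = 1" "p dvd u" "degree p \<ge> 1" if "p \<in> S" for p
  proof -
    show irr: "Factorial_Ring.irreducible p" and "lead_coeff p = 1" "p dvd u"
      using that by (simp_all add: S_def)
    have "p \<noteq> 0" using irr by auto
    then have "degree p \<noteq> 0" using irreducible_not_unit[OF irr] by (simp add: is_unit_iff_degree)
    then show "degree p \<ge> 1" by simp
  qed
  \<comment> \<open>Stated for finite subsets, because the finiteness of \<open>S\<close> is itself
    derived from this bound.\<close>
  have sum: "(\<Sum>p\<in>T. degree p) \<le> degree u" if T: "finite T" "T \<subseteq> S" for T
  proof -
    have "\<Prod>T dvd u" using prod_monic_irreducible_dvd[of T u] T S by blast
    then have "degree (\<Prod>T) \<le> degree u" using assms(1) by (rule dvd_imp_degree_le)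
    moreover have "degree (\<Prod>T) = (\<Sum>p\<in>T. degree p)"
      using T S(2) by (intro degree_prod_eq_sum_degree) fastforce
    ultimately show ?thesis by simp
  qed
  have card: "card T \<le> (\<Sum>p\<in>T. degree p)" if "finite T" "T \<subseteq> S" for T
    using sum_mono[of T "\<lambda>_. 1" degree] S(4) that by fastforce
  show fin: "finite S"
  proof (rule ccontr)
    assume "infinite S"
    then obtain T where T: "T \<subseteq> S" "finite T" "card T = Suc (degree u)"
      using infinite_arbitrarily_large by blast
    then show False using sum[OF T(2,1)] card[OF T(2,1)] T(3) by linarith
  qed
  show "card S \<le> degree u" using sum[OF fin] card[OF fin] by auto
  define lin where "lin a = [:- a, 1:]" for a :: 'a
  have lin_inj: "inj_on lin A" for A by (auto simp: inj_on_def lin_def)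
  have lin_S: "lin ` {a. poly u a = 0} \<subseteq> S"
    by (auto simp: lin_def S_def irreducible_linear poly_eq_0_iff_dvd)
  from card_mono[OF fin this] show "card {a. poly u a = 0} \<le> card S"
    by (simp add: card_image[OF lin_inj])
  assume eq: "card S = degree u"
  have "S \<subseteq> lin ` {a. poly u a = 0}"
  proof
    fix p assume p: "p \<in> S"
    have "degree p + card (S - {p}) \<le> degree p + (\<Sum>q\<in>S - {p}. degree q)"
      using card[of "S - {p}"] fin by auto
    also have "\<dots> = (\<Sum>q\<in>S. degree q)" using sum.remove[OF fin p, of degree] by simp
    also have "\<dots> \<le> card (S - {p}) + 1"
      using sum[OF fin] eq card.remove[OF fin p] by simp
    finally have "degree p = 1" using S(4)[OF p] by simp
    then obtain c e where "p = [:c, e:]" by (metis degree1_coeffs)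
    then have "p = lin (- c)" using S(2)[OF p] \<open>degree p = 1\<close> by (auto simp: lin_def split: if_splits)
    moreover from this have "poly u (- c) = 0"
      using S(3)[OF p] by (simp add: lin_def poly_eq_0_iff_dvd)
    ultimately show "p \<in> lin ` {a. poly u a = 0}" by blast
  qed
  with lin_S have "S = lin ` {a. poly u a = 0}" by blast
  then show "card {a. poly u a = 0} = card S" by (simp add: card_image[OF lin_inj])
qed

section \<open>Fibres of the rational function\<close>

lemma ratfun_eval_Affine_iff:
  assumes "num_denom h = (f, g)"
  shows "ratfun_eval h (Affine a) = Affine b \<longleftrightarrow> poly (f - smult b g) a = 0"
proof -
  \<comment> \<open>Excludes a common zero of \<open>f\<close> and \<open>g\<close>, where
    \<open>f - b g\<close> would vanish although the value is defined to be
    \<open>Infinity\<close>.\<close>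
  have "poly f a \<noteq> 0" if "poly g a = 0"
    using num_denom_props(1)[OF assms] that coprime_poly_0 by blast
  then show ?thesis using assms by (auto simp: field_simps)
qed

text \<open>Leading terms can cancel only when \<open>f\<close> and \<open>g\<close> have equal
  degree, and then \<open>g\<close> alone still attains the maximum.\<close>

lemma ratfun_degree_shift:
  assumes "num_denom h = (f, g)"
  shows "ratfun_degree h = max (degree (f - smult b g)) (degree g)"
proof (cases "degree f = degree g")
  case True
  then have "degree (f - smult b g) \<le> degree g"
    using degree_smult_le[of b g] by (intro degree_diff_le) simp_all
  then show ?thesis using True assms by (simp add: ratfun_degree_def)
next
  case False
  then show ?thesis
  proof (cases "degree f < degree g")
    case True
    then have "degree (f - smult b g) \<le> degree g"
    using degree_smult_le[of b g] by (intro degree_diff_le) simp_all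
    then show ?thesis using True assms by (simp add: ratfun_degree_def)
  next
    assume "\<not> degree f < degree g"
    then have "degree (- smult b g) < degree f" using False degree_smult_le[of b g] by simp
    then have "degree (f + - smult b g) = degree f" by (rule degree_add_eq_left)
    then show ?thesis using \<open>\<not> degree f < degree g\<close> assms by (simp add: ratfun_degree_def)
  qed
qed

lemma ratfun_eval_Infinity_iff:
  assumes "num_denom h = (f, g)" "h \<notin> constants"
  shows "ratfun_eval h Infinity = Affine b \<longleftrightarrow> degree (f - smult b g) < degree g"
proof -
  let ?d = "ratfun_degree h" and ?N = "f - smult b g"
  note d = ratfun_degree_shift[OF assms(1), of b]
  have "ratfun_eval h Infinity = Affine b \<longleftrightarrow> coeff g ?d \<noteq> 0 \<and> coeff ?N ?d = 0"
    using assms(1) by (auto simp: Let_def field_simps)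
  also have "\<dots> \<longleftrightarrow> degree ?N < degree g"
  proof
    assume c: "coeff g ?d \<noteq> 0 \<and> coeff ?N ?d = 0"
    then have "?d = degree g" using d le_degree[of g ?d] by simp
    \<comment> \<open>A vanishing coefficient at \<open>degree ?N\<close> means
      \<open>?N = 0\<close>, of degree 0 by convention; positivity of \<open>?d\<close> excludes
      this case.\<close>
    moreover have "degree ?N \<noteq> ?d"
      using c ratfun_degree_pos[OF assms(2)] by (metis degree_0 leading_coeff_0_iff less_irrefl)
    ultimately show "degree ?N < degree g" using d by simp
  next
    assume "degree ?N < degree g"
    moreover from this have deg: "?d = degree g" using d by simp
    ultimately have "coeff ?N ?d = 0" by (intro coeff_eq_0) simp
    moreover have "coeff g ?d \<noteq> 0" using num_denom_props(2)[OF assms(1)] deg by simp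
    ultimately show "coeff g ?d \<noteq> 0 \<and> coeff ?N ?d = 0" by blast
  qed
  finally show ?thesis .
qed

theorem proposition4p1:
  fixes h t :: "'a::{field, finite} poly fract" and a b :: 'a
  assumes "h \<notin> constants" and "t = h"
  shows "(ratfun_eval h (Affine a) = Affine b \<longleftrightarrow>
            lies_over ratfun_field constants UNIV (subfield_gen t) (place_x a) (place_t t b)) \<and>
         (card {Q. ratfun_eval h Q = Affine b} = ratfun_degree h \<longleftrightarrow>
            splits_totally ratfun_field constants UNIV (subfield_gen t) (place_t t b))"
proof -
  have t: "t \<notin> constants" using assms by simp
  obtain f g where fg: "num_denom t = (f, g)" by fastforce
  note nd = num_denom_props[OF fg]
  define N where "N = f - smult b g"
  have tb: "t - const_fun b = to_fract N / to_fract g"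
  proof -
    have "to_fract (smult b g) = const_fun b * to_fract g"
      using poly_at_smult[of x_fun b g] by (simp del: poly_at_smult)
    then show ?thesis using nd by (simp add: N_def diff_divide_distrib)
  qed
  have N0: "N \<noteq> 0"
  proof
    assume "N = 0"
    then have "t = const_fun b" using tb by simp
    then show False using t by simp
  qed
  have cop: "coprime N g"
  proof (rule coprimeI)
    fix c assume c: "c dvd N" "c dvd g"
    then have "c dvd N + smult b g" by (intro dvd_add dvd_smult)
    then show "is_unit c" using c(2) nd(1) by (auto simp: N_def coprime_def)
  qed
  define S where "S = {p. Factorial_Ring.irreducible p \<and> lead_coeff p = 1 \<and> p dvd N}"
  \<comment> \<open>The contribution of infinity, the same for the places over \<open>P_b\<close>
    and for the fibre.\<close>
  define \<epsilon> :: nat where "\<epsilon> = (if degree N < degree g then 1 else 0)"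
  note S_facts = monic_irreducible_divisors[OF N0, folded S_def]
  have mem_at: "t - const_fun b \<in> place_at x_fun p \<longleftrightarrow> p dvd N" if "Factorial_Ring.irreducible p" for p
    unfolding tb by (rule divide_in_place_at_x_fun_iff[OF that cop nd(2)])
  have mem_inf: "t - const_fun b \<in> place_infinity \<longleftrightarrow> degree N < degree g"
    unfolding tb by (rule divide_in_place_infinity_iff[OF N0 nd(2)])
  let ?over = "\<lambda>P. lies_over ratfun_field constants UNIV (subfield_gen t) P (place_t t b)"
  note over_iff = lies_over_place_t_iff[OF t, of _ b]
  have part1: "ratfun_eval t (Affine a) = Affine b \<longleftrightarrow> ?over (place_x a)"
  proof -
    have "place ratfun_field constants UNIV (place_x a)"
      unfolding place_x_eq place_ratfun_iff using irreducible_linear[of "- a"] by force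
    then have "?over (place_x a) \<longleftrightarrow> [:- a, 1:] dvd N"
      using over_iff mem_at[OF irreducible_linear] place_x_eq by metis
    then show ?thesis
      unfolding ratfun_eval_Affine_iff[OF fg] N_def[symmetric] by (simp add: poly_eq_0_iff_dvd)
  qed
  have "{P. ?over P} = place_at x_fun ` S \<union> (if degree N < degree g then {place_infinity} else {})"
  proof (intro equalityI subsetI)
    fix P assume "P \<in> {P. ?over P}"
    then have "place ratfun_field constants UNIV P" "t - const_fun b \<in> P"
      using over_iff by auto
    then show "P \<in> place_at x_fun ` S \<union> (if degree N < degree g then {place_infinity} else {})"
      unfolding place_ratfun_iff using mem_at mem_inf by (auto simp: S_def)
  next
    fix P assume "P \<in> place_at x_fun ` S \<union> (if degree N < degree g then {place_infinity} else {})"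
    then show "P \<in> {P. ?over P}"
      unfolding mem_Collect_eq over_iff place_ratfun_iff
      using mem_at mem_inf by (auto simp: S_def split: if_splits)
  qed
  moreover have "inj_on (place_at x_fun) S"
    using place_at_x_fun_inj by (auto simp: inj_on_def S_def)
  moreover have "place_infinity \<notin> place_at x_fun ` S"
    using place_at_x_fun_neq_infinity by (auto simp: S_def)
  ultimately have card_over: "card {P. ?over P} = card S + \<epsilon>"
    using S_facts(1) by (simp add: card_image \<epsilon>_def)
  have "{Q. ratfun_eval t Q = Affine b} =
      Affine ` {a. poly N a = 0} \<union> (if degree N < degree g then {Infinity} else {})"
  proof (rule Set.set_eqI)
    fix Q
    show "Q \<in> {Q. ratfun_eval t Q = Affine b} \<longleftrightarrow>
        Q \<in> Affine ` {a. poly N a = 0} \<union> (if degree N < degree g then {Infinity} else {})"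
      unfolding mem_Collect_eq
      by (cases Q) (auto simp: ratfun_eval_Affine_iff[OF fg] ratfun_eval_Infinity_iff[OF fg t] N_def
          simp del: ratfun_eval.simps)
  qed
  moreover have "card (Affine ` {a. poly N a = 0}) = card {a. poly N a = 0}"
    by (rule card_image) (simp add: inj_on_def)
  ultimately have card_fibre: "card {Q. ratfun_eval t Q = Affine b} = card {a. poly N a = 0} + \<epsilon>"
    using poly_roots_finite[OF N0] by (auto simp: \<epsilon>_def card_insert_if)
  have dim: "ring.dimension ratfun_field (ratfun_degree t) (subfield_gen t) UNIV"
    by (rule dimension_ratfun_field[OF t])
  interpret L: field "ratfun_field :: 'a poly fract ring" by (rule field_from_type_algebra)
  have "place ratfun_field constants (subfield_gen t) (place_t t b)"
    unfolding place_t_eq[OF t] by (rule place_place_at[OF t irreducible_linear])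
  moreover have "L.dim (subfield_gen t) UNIV = ratfun_degree t"
    using L.dimI[OF subfield_gen_subfield dim] by (simp add: over_def)
  ultimately have "splits_totally ratfun_field constants UNIV (subfield_gen t) (place_t t b) \<longleftrightarrow>
      card S + \<epsilon> = ratfun_degree t"
    unfolding splits_totally_def card_over using L.finite_dimensionI[OF dim] by simp
  moreover have "degree N + \<epsilon> \<le> ratfun_degree t"
    using ratfun_degree_shift[OF fg, of b] by (simp add: N_def \<epsilon>_def)
  \<comment> \<open>From \<open>#roots <= card S <= degree N\<close>, either count can reach the
    degree only if \<open>card S = degree N\<close>, and in that case roots and divisors are equally
    many.\<close>
  then have "card {a. poly N a = 0} + \<epsilon> = ratfun_degree t \<longleftrightarrow> card S + \<epsilon> = ratfun_degree t"
    using S_facts(2,3,4) by linarith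
  ultimately show ?thesis using part1 card_fibre assms(2) by simp
qed

end
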